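(* Let $f\in\mathcal F$. As $\varepsilon\to0$, the finite-dimensional distributions of the random field $\eta^\varepsilon(t,z):=\varepsilon^{-1/2}\big(\mathsf H^\varepsilon(t,z)-H(t,z)\big)$, $(t,z)\in\mathbb R^2$, converge to those of the Lévy–Chentsov field $\eta$ on $\mathbb R^2$ associated with the distance $$\mathrm d(\mathsf a,\mathsf b):=\iiint f(x,v,r)\,r^2\,\mathbf 1\{\{(s,x+vs):s\in\mathbb R\}\cap[\mathsf a,\mathsf b]\neq\emptyset\}\,dx\,dv\,dr .$$ In particular, for every finite set $N\subset\mathbb R^3$, $$\Big(\varepsilon^{-1/2}\big(\mathsf y^\varepsilon_{v,t}(x)-y_{v,t}(x)\big)\Big)_{(x,v,t)\in N}\ \xrightarrow[\varepsilon\to0]{\text{law}}\ \big(\eta(t,x+vt)\big)_{(x,v,t)\in N}.$$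
   Context: Let $\mathcal L$ be the set of measurable $\gamma:\mathbb R^2\to\mathbb R_{\ge0}$ with $\iint (v^2+r^2+1)\gamma(v,r)\,dv\,dr<\infty$. For measurable $f:\mathbb R^3\to\mathbb R_{\ge0}$ write $\sigma_f(x):=\iint r\,f(x,v,r)\,dv\,dr$. The class $\mathcal F$ consists of measurable $f:\mathbb R^3\to\mathbb R_{\ge0}$ for which there is $\gamma\in\mathcal L$ such that for every $(v,r)\in\mathbb R^2$ the map $x\mapsto f(x,v,r)$ is $C^1$ with $\sup_x|f(x,v,r)|\le\gamma(v,r)$ and $\sup_x|\partial_xf(x,v,r)|\le\gamma(v,r)$, and such that $\sigma_f(x)>0$ for all $x\in\mathbb R$. $\mathsf X^\varepsilon$ is a Poisson process on $\mathbb R^3$ with intensity $\varepsilon^{-1}f$ (obtained as $\{(x,v,r):(x,v,r,z)\in\mathbf X,0<z<\varepsilon^{-1}\}$ from a Poisson process $\mathbf X$ on $\mathbb R^4$ with intensity $f\,dx\,dv\,dr\,dz$). Define $\mathsf H^\varepsilon(t,x):=\varepsilon\sum_{(z,w,r)\in\mathsf X^\varepsilon} r\big(\mathbf 1\{z\ge0,\,z+wt<x\}-\mathbf 1\{z<0,\,z+wt\ge x\}\big)$, $H(t,x):=\mathbb E\mathsf H^\varepsilon(t,x)=\iiint f(z,w,r)\,r\big(\mathbf 1\{z\ge0,\,z+wt<x\}-\mathbf 1\{z<0,\,z+wt\ge x\}\big)\,dz\,dw\,dr$, $\mathsf y^\varepsilon_{v,t}(x):=x+vt+\mathsf H^\varepsilon(t,x+vt)$,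 $y_{v,t}(x):=x+vt+H(t,x+vt)$. Points of $\mathbb R^2$ are written $(t,x)$ (time, space); $\mathsf o=(0,0)$; for $\mathsf a,\mathsf b\in\mathbb R^2$, $[\mathsf a,\mathsf b]:=\{(1-u)\mathsf a+u\mathsf b:u\in[0,1]\}$. A triple $(x,v,r)$ is identified with the line $\{(s,x+vs):s\in\mathbb R\}$ marked by $r$. A Lévy–Chentsov field associated with a distance $\mathrm d$ on $\mathbb R^2$ is a centered Gaussian process $(\eta(\mathsf a))_{\mathsf a\in\mathbb R^2}$ with $\eta(\mathsf o)=0$ and $\operatorname{Cov}(\eta(\mathsf a),\eta(\mathsf b))=\tfrac12\big(\mathrm d(\mathsf o,\mathsf a)+\mathrm d(\mathsf o,\mathsf b)-\mathrm d(\mathsf a,\mathsf b)\big)$.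
   Formalization: The Lévy–Chentsov field for d is assumed to exist, which amounts to d being finite; f in the class F alone does not ensure this, e.g. f = r^{-4} on {r>1, |v-r|<1} gives d((0,0),(1,0)) = ∞. *)

theory Defs
  imports "HOL-Analysis.Analysis" "HOL-Probability.Probability"
begin

definition class_L :: "(real \<times> real \<Rightarrow> real) set" where
  "class_L = {\<gamma>. \<gamma> \<in> borel_measurable borel \<and> (\<forall>p. 0 \<le> \<gamma> p) \<and>
     (\<integral>\<^sup>+ p. ennreal ((fst p ^ 2 + snd p ^ 2 + 1) * \<gamma> p) \<partial>(lborel :: (real \<times> real) measure)) < \<infinity>}"

definition sigma_f :: "(real \<times> real \<times> real \<Rightarrow> real) \<Rightarrow> real \<Rightarrow> real" where
  "sigma_f f x = (\<integral>p. snd p * f (x, fst p, snd p) \<partial>(lborel :: (real \<times> real) measure))"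

definition class_F :: "(real \<times> real \<times> real \<Rightarrow> real) set" where
  "class_F = {f. f \<in> borel_measurable borel \<and> (\<forall>p. 0 \<le> f p) \<and>
     (\<exists>\<gamma>\<in>class_L. \<forall>v r. \<exists>f'. continuous_on UNIV f' \<and>
          (\<forall>x. ((\<lambda>x. f (x, v, r)) has_real_derivative f' x) (at x)) \<and>
          (\<forall>x. \<bar>f (x, v, r)\<bar> \<le> \<gamma> (v, r)) \<and> (\<forall>x. \<bar>f' x\<bar> \<le> \<gamma> (v, r))) \<and>
     (\<forall>x. sigma_f f x > 0)}"

definition poisson_point_process ::
    "'a measure \<Rightarrow> ('b::metric_space) measure \<Rightarrow> ('a \<Rightarrow> 'b set) \<Rightarrow> bool" where
  "poisson_point_process M Lambda X \<longleftrightarrow> prob_space M \<and> sets Lambda = sets borel \<and>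
     (\<forall>\<omega>\<in>space M. \<forall>B. bounded B \<longrightarrow> finite (X \<omega> \<inter> B)) \<and>
     (\<forall>A\<in>sets borel. bounded A \<longrightarrow>
        (\<lambda>\<omega>. card (X \<omega> \<inter> A)) \<in> measurable M (count_space UNIV)) \<and>
     (\<forall>(I::nat set) (A::nat \<Rightarrow> 'b set). finite I \<longrightarrow>
        (\<forall>i\<in>I. A i \<in> sets borel \<and> bounded (A i) \<and> emeasure Lambda (A i) < \<infinity>) \<longrightarrow>
        disjoint_family_on A I \<longrightarrow>
        prob_space.indep_vars M (\<lambda>_. count_space UNIV) (\<lambda>i \<omega>. card (X \<omega> \<inter> A i)) I \<and>
        (\<forall>i\<in>I. \<forall>k::nat. measure M {\<omega>\<in>space M. card (X \<omega> \<inter> A i) = k} =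
              measure Lambda (A i) ^ k / fact k * exp (- measure Lambda (A i))))"

text \<open>X is a Poisson process on R^4 (points (x,v,r,z)); X_eps is its thinning to 0 < z < 1/eps,
  projected to R^3.\<close>

definition X_eps :: "real \<Rightarrow> ('a \<Rightarrow> (real \<times> real \<times> real \<times> real) set) \<Rightarrow> 'a \<Rightarrow> (real \<times> real \<times> real) set" where
  "X_eps \<epsilon> X \<omega> = (\<lambda>(x, v, r, z). (x, v, r)) ` {(x, v, r, z) \<in> X \<omega>. 0 < z \<and> z < 1 / \<epsilon>}"

definition kernel_H :: "real \<Rightarrow> real \<Rightarrow> real \<times> real \<times> real \<Rightarrow> real" where
  "kernel_H t x p = (case p of (z, w, r) \<Rightarrow>
      r * ((if 0 \<le> z \<and> z + w * t < x then 1 else 0) - (if z < 0 \<and> z + w * t \<ge> x then 1 else 0)))"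

definition H_eps :: "real \<Rightarrow> ('a \<Rightarrow> (real \<times> real \<times> real \<times> real) set) \<Rightarrow> real \<Rightarrow> real \<Rightarrow> 'a \<Rightarrow> real" where
  "H_eps \<epsilon> X t x \<omega> = \<epsilon> * (\<Sum>\<^sub>\<infinity> p \<in> X_eps \<epsilon> X \<omega>. kernel_H t x p)"

definition H_mean :: "(real \<times> real \<times> real \<Rightarrow> real) \<Rightarrow> real \<Rightarrow> real \<Rightarrow> real" where
  "H_mean f t x = (\<integral>p. f p * kernel_H t x p \<partial>(lborel :: (real \<times> real \<times> real) measure))"

definition y_eps :: "real \<Rightarrow> ('a \<Rightarrow> (real \<times> real \<times> real \<times> real) set) \<Rightarrow> real \<Rightarrow> real \<Rightarrow> real \<Rightarrow> 'a \<Rightarrow> real" where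
  "y_eps \<epsilon> X v t x \<omega> = x + v * t + H_eps \<epsilon> X t (x + v * t) \<omega>"

definition y_mean :: "(real \<times> real \<times> real \<Rightarrow> real) \<Rightarrow> real \<Rightarrow> real \<Rightarrow> real \<Rightarrow> real" where
  "y_mean f v t x = x + v * t + H_mean f t (x + v * t)"

definition eta_eps :: "(real \<times> real \<times> real \<Rightarrow> real) \<Rightarrow> real \<Rightarrow> ('a \<Rightarrow> (real \<times> real \<times> real \<times> real) set) \<Rightarrow> real \<times> real \<Rightarrow> 'a \<Rightarrow> real" where
  "eta_eps f \<epsilon> X a \<omega> = (H_eps \<epsilon> X (fst a) (snd a) \<omega> - H_mean f (fst a) (snd a)) / sqrt \<epsilon>"

definition line_dist :: "(real \<times> real \<times> real \<Rightarrow> real) \<Rightarrow> real \<times> real \<Rightarrow> real \<times> real \<Rightarrow> real" where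
  "line_dist f a b = (\<integral>p. (case p of (x, v, r) \<Rightarrow>
      f (x, v, r) * r ^ 2 *
      indicator {(x, v, r). range (\<lambda>s. (s, x + v * s)) \<inter> closed_segment a b \<noteq> {}} (x, v, r))
      \<partial>(lborel :: (real \<times> real \<times> real) measure))"

definition centered_gaussian_rv :: "'a measure \<Rightarrow> ('a \<Rightarrow> real) \<Rightarrow> bool" where
  "centered_gaussian_rv M Y \<longleftrightarrow> Y \<in> borel_measurable M \<and>
     ((AE \<omega> in M. Y \<omega> = 0) \<or> (\<exists>\<sigma>>0. distributed M lborel Y (normal_density 0 \<sigma>)))"

definition centered_gaussian_process :: "'a measure \<Rightarrow> ('i \<Rightarrow> 'a \<Rightarrow> real) \<Rightarrow> bool" where
  "centered_gaussian_process M \<eta> \<longleftrightarrow> prob_space M \<and>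
     (\<forall>S c. finite S \<longrightarrow> centered_gaussian_rv M (\<lambda>\<omega>. \<Sum>i\<in>S. c i * \<eta> i \<omega>))"

definition covariance :: "'a measure \<Rightarrow> ('a \<Rightarrow> real) \<Rightarrow> ('a \<Rightarrow> real) \<Rightarrow> real" where
  "covariance M Y Z = (\<integral>\<omega>. (Y \<omega> - (\<integral>\<omega>'. Y \<omega>' \<partial>M)) * (Z \<omega> - (\<integral>\<omega>'. Z \<omega>' \<partial>M)) \<partial>M)"

definition levy_chentsov_field ::
    "'a measure \<Rightarrow> (real \<times> real \<Rightarrow> real \<times> real \<Rightarrow> real) \<Rightarrow> (real \<times> real \<Rightarrow> 'a \<Rightarrow> real) \<Rightarrow> bool" where
  "levy_chentsov_field M d \<eta> \<longleftrightarrow> centered_gaussian_process M \<eta> \<and>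
     (AE \<omega> in M. \<eta> (0, 0) \<omega> = 0) \<and>
     (\<forall>a b. covariance M (\<eta> a) (\<eta> b) = (d (0, 0) a + d (0, 0) b - d a b) / 2)"

definition conv_law_at0 ::
    "'a measure \<Rightarrow> (real \<Rightarrow> 'a \<Rightarrow> 'v::topological_space) \<Rightarrow> 'b measure \<Rightarrow> ('b \<Rightarrow> 'v) \<Rightarrow> bool" where
  "conv_law_at0 M Y M' Z \<longleftrightarrow>
     (\<forall>\<phi> :: 'v \<Rightarrow> real. continuous_on UNIV \<phi> \<longrightarrow> bounded (range \<phi>) \<longrightarrow>
        ((\<lambda>\<epsilon>. \<integral>u. \<phi> u \<partial>(distr M borel (Y \<epsilon>)))
           \<longlongrightarrow> (\<integral>u. \<phi> u \<partial>(distr M' borel Z))) (at_right 0))"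

end

theory Submission
  imports Defs
begin

text \<open>For a linear combination \<open>g\<close> of the kernels of \<open>H\<close> at finitely many points, the
  characteristic functional of the Poisson process gives
  \<open>E exp (i \<Sum> w\<^sub>j \<eta>\<^sup>\<epsilon>(a\<^sub>j)) = exp (\<integral> f (exp (i \<surd>\<epsilon> g) - 1 - i \<surd>\<epsilon> g) / \<epsilon>)\<close>,
  which tends to \<open>exp (- \<integral> f g\<^sup>2 / 2)\<close> by dominated convergence.
  The kernel at \<open>a\<close> is \<open>r (side a - side o)\<close>, where \<open>side a\<close> tells whether the line passes below
  \<open>a\<close>, and almost every line meets \<open>[a, b]\<close> iff \<open>side a \<noteq> side b\<close>. Hence \<open>d(a, b)\<close> is the squared
  distance of the two kernels in \<open>L\<^sup>2(f)\<close>, the Levy-Chentsov covariance is their inner product,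
  and the limit is the characteristic function of the Gaussian vector. Convergence in law
  follows from a multivariate version of the continuity theorem.\<close>

section \<open>Multivariate continuity theorem\<close>

text \<open>Three obstacles shape the proof. \<open>X_eps\<close> is a set image, so two points of
  \<open>X\<close> with the same first three coordinates would be counted once. Such coincidences
  have probability zero: a slab of width 1/m holds two points with probability of order 1/m^2, and
  only of order m slabs are needed. Replacing integrands almost surely also requires measurable sums
  over \<open>X_eps\<close>, which is not automatic for an image set and is obtained by counting
  cells. Next, the defining property of a Poisson process speaks of bounded sets, whereas the
  kernels have unbounded support in velocity and mark. The characteristic functional is therefore
  computed for simple functions of bounded support and extended by domination, with almost sure
  absolute convergence from Campbell's formula. Finally, the moments in \<open>class_L\<close> do
  not control r^2 |v|, so integrability of the squared kernels is extracted from the existence of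
  the limit field. The scaling is exact: centring by \<open>H_mean\<close> cancels the first-order
  term, and the factor 1/eps of the intensity cancels the square of sqrt eps in the second.\<close>

inductive trig_poly :: "('v::real_inner \<Rightarrow> real) \<Rightarrow> bool" where
  cos: "trig_poly (\<lambda>u. a * cos (w \<bullet> u + c))"
| add: "trig_poly g \<Longrightarrow> trig_poly h \<Longrightarrow> trig_poly (\<lambda>u. g u + h u)"

text \<open>Product-to-sum formula. The free phase \<open>c\<close> lets cosines alone express sines
  and constants, so the class becomes an algebra whose integrals are determined by the
  characteristic function.\<close>

lemma trig_poly_mult_cos:
  assumes "trig_poly h"
  shows "trig_poly (\<lambda>u. a * cos (w \<bullet> u + c) * h u)"
  using assms
proof induction
  case (cos a' w' c')
  have eq: "a * cos (w \<bullet> u + c) * (a' * cos (w' \<bullet> u + c')) =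
     (a * a' / 2) * cos ((w - w') \<bullet> u + (c - c')) + (a * a' / 2) * cos ((w + w') \<bullet> u + (c + c'))" for u
    using cos_times_cos[of "w \<bullet> u + c" "w' \<bullet> u + c'"]
    by (simp add: inner_diff_left inner_add_left algebra_simps add_divide_distrib diff_divide_distrib)
  show ?case unfolding eq by (intro trig_poly.intros)
next
  case (add g h)
  then show ?case by (simp add: distrib_left trig_poly.add)
qed

lemma trig_poly_mult:
  assumes "trig_poly g" "trig_poly h"
  shows "trig_poly (\<lambda>u. g u * h u)"
  using assms(1)
  by induction (simp_all add: distrib_right trig_poly.add trig_poly_mult_cos assms(2))

lemma trig_poly_const: "trig_poly (\<lambda>u. c)"
  using trig_poly.cos[of c 0 0] by simp

lemma trig_poly_sum:
  assumes "finite A" "\<And>i. i \<in> A \<Longrightarrow> trig_poly (g i)"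
  shows "trig_poly (\<lambda>u. \<Sum>i\<in>A. g i u)"
  using assms by (induction A rule: finite_induct) (simp_all add: trig_poly_const trig_poly.add)

text \<open>A sine is a cosine with phase -pi/2, which settles linear functions; closure under sums
  and products does the rest. This makes the Stone-Weierstrass approximants accessible to
  characteristic functions.\<close>

lemma real_polynomial_function_sin_trig_poly:
  fixes p :: "real ^ 'n \<Rightarrow> real"
  assumes "real_polynomial_function p"
  shows "trig_poly (\<lambda>u :: real ^ 'n. p (\<chi> j. sin (u $ j / K)))"
  using assms
proof induction
  case (linear p)
  interpret bounded_linear p by fact
  have "p (\<chi> j. sin (u $ j / K)) =
    (\<Sum>j\<in>UNIV. p (axis j 1) * cos (((1 / K) *\<^sub>R axis j 1) \<bullet> u + - (pi / 2)))" for u :: "real ^ 'n"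
  proof -
    have "(\<chi> j. sin (u $ j / K)) = (\<Sum>j\<in>UNIV. sin (u $ j / K) *\<^sub>R (axis j 1 :: real ^ 'n))"
      by (simp add: vec_eq_iff axis_def if_distrib sum.delta cong: if_cong)
    then have "p (\<chi> j. sin (u $ j / K)) = (\<Sum>j\<in>UNIV. sin (u $ j / K) * p (axis j 1))"
      by (simp only: sum scaleR real_scaleR_def)
    also have "\<dots> = (\<Sum>j\<in>UNIV. p (axis j 1) * cos (((1 / K) *\<^sub>R axis j 1) \<bullet> u + - (pi / 2)))"
      by (intro sum.cong refl) (simp add: inner_axis' cos_add cos_diff)
    finally show ?thesis .
  qed
  then show ?case
    by (simp only:) (intro trig_poly_sum trig_poly.cos finite)
qed (simp_all add: trig_poly_const trig_poly.add trig_poly_mult)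

lemma trig_poly_measurable_bounded:
  fixes g :: "'v::euclidean_space \<Rightarrow> real"
  assumes "trig_poly g"
  shows "g \<in> borel_measurable borel \<and> (\<exists>B. \<forall>u. \<bar>g u\<bar> \<le> B)"
  using assms
proof induction
  case (cos a w c)
  have "\<bar>a * cos (w \<bullet> u + c)\<bar> \<le> \<bar>a\<bar>" for u
    by (simp add: abs_mult mult_left_le)
  then show ?case by auto
next
  case (add g h)
  then obtain B C where "\<And>u. \<bar>g u\<bar> \<le> B" "\<And>u. \<bar>h u\<bar> \<le> C" by auto
  then have "\<bar>g u + h u\<bar> \<le> B + C" for u
    by (rule order_trans[OF abs_triangle_ineq add_mono])
  with add show ?case by auto
qed

text \<open>The integral of a shifted cosine is the real part of the characteristic function at
  \<open>w\<close>, rotated by the phase.\<close>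

lemma trig_poly_integral_tendsto:
  fixes \<mu> :: "nat \<Rightarrow> 'v::euclidean_space measure"
  assumes prob: "\<And>n. prob_space (\<mu> n)" "prob_space \<nu>"
    and sets: "\<And>n. sets (\<mu> n) = sets borel" "sets \<nu> = sets borel"
    and char: "\<And>w. (\<lambda>n. CLINT u|\<mu> n. iexp (w \<bullet> u)) \<longlonglongrightarrow> (CLINT u|\<nu>. iexp (w \<bullet> u))"
    and "trig_poly g"
  shows "(\<lambda>n. LINT u|\<mu> n. g u) \<longlonglongrightarrow> (LINT u|\<nu>. g u)"
  using assms(6)
proof induction
  case (cos a w c)
  have *: "(LINT u|m. a * cos (w \<bullet> u + c)) = a * Re (cis c * (CLINT u|m. iexp (w \<bullet> u)))"
    if "prob_space m" "sets m = sets borel" for m :: "'v measure"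
  proof -
    interpret prob_space m by fact
    have [measurable_cong]: "sets m = sets borel" by fact
    have int: "integrable m (\<lambda>u. iexp (w \<bullet> u))"
      by (rule integrable_const_bound[where B=1]) auto
    have "(LINT u|m. a * cos (w \<bullet> u + c)) = (LINT u|m. a * Re (cis c * iexp (w \<bullet> u)))"
      by (intro Bochner_Integration.integral_cong refl)
         (simp add: cis_conv_exp[symmetric] cis_mult add.commute)
    also have "\<dots> = a * Re (CLINT u|m. cis c * iexp (w \<bullet> u))"
      using int by (subst integral_mult_right_zero, subst integral_Re) auto
    finally show ?thesis by (subst (asm) integral_mult_right_zero)
  qed
  show ?case
    unfolding *[OF prob(1) sets(1)] *[OF prob(2) sets(2)]
    by (intro tendsto_intros char)
next
  case (add g h)
  have int: "integrable m k" if "trig_poly k" "prob_space m" "sets m = sets borel"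
    for m :: "'v measure" and k
  proof -
    interpret prob_space m by fact
    note k = trig_poly_measurable_bounded[OF that(1)]
    note [measurable_cong] = that(3)
    obtain B where "\<And>u. \<bar>k u\<bar> \<le> B" "k \<in> borel_measurable borel"
      using k by auto
    then show ?thesis
      by (intro integrable_const_bound[where B=B])
         auto
  qed
  show ?case
    using add int prob sets by (simp add: tendsto_add)
qed

text \<open>The tails are controlled by the one-dimensional theorem applied to the coordinates; on a
  box the test function is a continuous function of the sines of the coordinates.\<close>
theorem levy_continuity_vec:
  fixes \<mu> :: "nat \<Rightarrow> (real ^ 'n) measure" and \<phi> :: "real ^ 'n \<Rightarrow> real"
  assumes prob: "\<And>n. prob_space (\<mu> n)" "prob_space \<nu>"
    and sets: "\<And>n. sets (\<mu> n) = sets borel" "sets \<nu> = sets borel"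
    and char: "\<And>w. (\<lambda>n. CLINT u|\<mu> n. iexp (w \<bullet> u)) \<longlonglongrightarrow> (CLINT u|\<nu>. iexp (w \<bullet> u))"
    and cont: "continuous_on UNIV \<phi>" and bdd: "bounded (range \<phi>)"
  shows "(\<lambda>n. LINT u|\<mu> n. \<phi> u) \<longlonglongrightarrow> (LINT u|\<nu>. \<phi> u)"
proof -
  interpret \<mu>: prob_space "\<mu> n" for n by (rule prob)
  interpret \<nu>: prob_space \<nu> by (rule prob)
  note [measurable_cong] = sets
  have [measurable]: "\<phi> \<in> borel_measurable borel"
    using cont by (rule borel_measurable_continuous_onI)
  obtain B where B: "\<And>u. \<bar>\<phi> u\<bar> \<le> B" and "B > 0"
    using bdd unfolding bounded_pos by auto
  \<comment> \<open>A continuous substitute for the indicator of a tail: 0 up to distance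
    \<open>K\<close>, 1 from \<open>K + 1\<close> on. Continuity lets weak convergence of the
    coordinates apply to it.\<close>
  define h where "h K x = max 0 (min 1 (\<bar>x\<bar> - K))" for K x :: real
  have h_meas [measurable]: "h K \<in> borel_measurable borel" for K
    unfolding h_def by measurable
  have h01: "0 \<le> h K x" "h K x \<le> 1" for K x by (auto simp: h_def)
  have hconv: "(\<lambda>n. LINT u|\<mu> n. h K (u $ j)) \<longlonglongrightarrow> (LINT u|\<nu>. h K (u $ j))" for K j
  proof -
    let ?d = "\<lambda>m. distr m borel (\<lambda>u. u $ j)"
    have rd: "real_distribution (?d (\<mu> n))" "real_distribution (?d \<nu>)" for n
      unfolding real_distribution_def real_distribution_axioms_def
      by (auto intro!: \<mu>.prob_space_distr \<nu>.prob_space_distr)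
    have ch: "Characteristic_Functions.char (?d m) t = (CLINT u|m. iexp ((t *\<^sub>R axis j 1) \<bullet> u))"
      if [measurable_cong]: "sets m = sets borel" for m t
      unfolding char_def by (subst integral_distr) (auto simp: inner_axis')
    have "weak_conv_m (\<lambda>n. ?d (\<mu> n)) (?d \<nu>)"
      by (rule levy_continuity[OF rd]) (simp only: ch sets char)
    then have "(\<lambda>n. LINT x|?d (\<mu> n). h K x) \<longlonglongrightarrow> (LINT x|?d \<nu>. h K x)"
      by (intro weak_conv_imp_integral_bdd_continuous_conv[where B=1] rd)
         (auto simp: h_def intro!: continuous_intros)
    then show ?thesis
      by (simp add: integral_distr)
  qed
  have hlim: "(\<lambda>K. LINT u|\<nu>. h (real K) (u $ j)) \<longlonglongrightarrow> (LINT u|\<nu>. 0)" for j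
  proof (rule integral_dominated_convergence[where w="\<lambda>_. 1"])
    show "AE u in \<nu>. (\<lambda>K. h (real K) (u $ j)) \<longlonglongrightarrow> 0"
    proof (rule AE_I2)
      fix u :: "real ^ 'n"
      obtain N :: nat where "\<bar>u $ j\<bar> \<le> real N" using real_arch_simple by blast
      then have "eventually (\<lambda>K. h (real K) (u $ j) = 0) sequentially"
        by (intro eventually_sequentiallyI[of N]) (auto simp: h_def)
      then show "(\<lambda>K. h (real K) (u $ j)) \<longlonglongrightarrow> 0" by (rule tendsto_eventually)
    qed
  qed (auto simp: h01)
  show ?thesis
  proof (rule LIMSEQ_I)
    fix e :: real assume "e > 0"
    \<comment> \<open>Passing from \<open>\<phi>\<close> to \<open>T\<close> costs less than two
      \<open>\<delta>\<close> under each of the two measures and the convergence for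
      \<open>T\<close> costs one more, so five of the eight parts are spent.\<close>
    define \<delta> where "\<delta> = e / 8"
    have "\<delta> > 0" and e8: "e = 8 * \<delta>" using \<open>e > 0\<close> by (simp_all add: \<delta>_def)
    have "(\<lambda>K. \<Sum>j\<in>UNIV. LINT u|\<nu>. h (real K) (u $ j)) \<longlonglongrightarrow> (\<Sum>j\<in>(UNIV::'n set). LINT u|\<nu>. 0)"
      by (intro tendsto_sum hlim)
    then have "eventually (\<lambda>K. (\<Sum>j\<in>UNIV. LINT u|\<nu>. h (real K) (u $ j)) < \<delta> / (2 * B)) sequentially"
      using \<open>\<delta> > 0\<close> \<open>B > 0\<close> by (intro order_tendstoD(2)) auto
    then obtain K0 :: nat where K0: "(\<Sum>j\<in>UNIV. LINT u|\<nu>. h (real K0) (u $ j)) < \<delta> / (2 * B)"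
      by (auto simp: eventually_sequentially)
    \<comment> \<open>\<open>h (real K0)\<close> reaches 1 at distance \<open>K0 + 1\<close>, so
      outside the box of half-width \<open>K\<close> the sum of the cutoffs is at least 1.\<close>
    define K where "K = real K0 + 1"
    have "K > 0" by (simp add: K_def)
    \<comment> \<open>On the box the quotients by \<open>K\<close> lie in [-1, 1], inside
      [-pi/2, pi/2], so \<open>K * arcsin\<close> undoes the sines. Off the box
      \<open>\<psi>\<close> still takes values of \<open>\<phi>\<close>, which costs at most
      \<open>2 * B\<close>.\<close>
    define \<psi> where "\<psi> s = \<phi> (\<chi> j. K * arcsin (s $ j))" for s :: "real ^ 'n"
    define S where "S = {s :: real ^ 'n. \<forall>j. s $ j \<in> {-1..1}}"
    have "S = cbox (\<chi> j. -1) (\<chi> j. 1)"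
      by (auto simp: S_def mem_box_cart)
    then have "compact S" by simp
    moreover have "continuous_on S \<psi>"
      unfolding \<psi>_def
      by (rule continuous_on_compose2[OF cont]) (auto simp: S_def intro!: continuous_intros)
    ultimately obtain p where p: "real_polynomial_function p"
      and p_close: "\<And>s. s \<in> S \<Longrightarrow> \<bar>\<psi> s - p s\<bar> < \<delta>"
      using Stone_Weierstrass_real_polynomial_function \<open>\<delta> > 0\<close> by metis
    define T where "T u = p (\<chi> j. sin (u $ j / K))" for u :: "real ^ 'n"
    have T: "trig_poly T"
      unfolding T_def using p by (rule real_polynomial_function_sin_trig_poly)
    obtain C where [measurable]: "T \<in> borel_measurable borel" and C: "\<And>u. \<bar>T u\<bar> \<le> C"
      using trig_poly_measurable_bounded[OF T] by auto
    have close: "\<bar>\<phi> u - T u\<bar> \<le> \<delta> + 2 * B * (\<Sum>j\<in>UNIV. h (real K0) (u $ j))" for u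
    proof -
      let ?s = "\<chi> j. sin (u $ j / K)"
      have s: "?s \<in> S" by (simp add: S_def)
      have "\<bar>\<phi> u - \<psi> ?s\<bar> \<le> 2 * B * (\<Sum>j\<in>UNIV. h (real K0) (u $ j))"
      proof (cases "\<forall>j. \<bar>u $ j\<bar> \<le> K")
        case True
        have "K * arcsin (sin (u $ j / K)) = u $ j" for j
        proof -
          have "\<bar>u $ j / K\<bar> \<le> 1" using True \<open>K > 0\<close> by simp
          then have "- (pi / 2) \<le> u $ j / K" "u $ j / K \<le> pi / 2"
            using pi_ge_two by linarith+
          then show ?thesis using \<open>K > 0\<close> by (simp add: arcsin_sin)
        qed
        then have "\<psi> ?s = \<phi> u" by (simp add: \<psi>_def)
        then show ?thesis using h01 \<open>B > 0\<close> by (simp add: sum_nonneg)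
      next
        case False
        then obtain j where "\<bar>u $ j\<bar> > K" by (auto simp: not_le)
        then have "1 \<le> h (real K0) (u $ j)" by (auto simp: h_def K_def)
        also have "\<dots> \<le> (\<Sum>j\<in>UNIV. h (real K0) (u $ j))"
          by (intro member_le_sum) (auto simp: h01)
        finally have "2 * B \<le> 2 * B * (\<Sum>j\<in>UNIV. h (real K0) (u $ j))"
          using \<open>B > 0\<close> by simp
        moreover have "\<bar>\<phi> u - \<psi> ?s\<bar> \<le> 2 * B"
          unfolding \<psi>_def using B[of u] B[of "\<chi> j. K * arcsin (?s $ j)"] by linarith
        ultimately show ?thesis by linarith
      qed
      with p_close[OF s] show ?thesis by (simp add: T_def)
    qed
    have bound: "\<bar>(LINT u|m. \<phi> u) - (LINT u|m. T u)\<bar>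
        \<le> \<delta> + 2 * B * (\<Sum>j\<in>UNIV. LINT u|m. h (real K0) (u $ j))"
      if "prob_space m" and [measurable_cong]: "sets m = sets borel" for m
    proof -
      interpret prob_space m by fact
      have int: "integrable m \<phi>" "integrable m T" "\<And>j. integrable m (\<lambda>u. h (real K0) (u $ j))"
        by (rule integrable_const_bound[where B=B] integrable_const_bound[where B=C]
              integrable_const_bound[where B=1]; use B C h01 in simp)+
      have "\<bar>(LINT u|m. \<phi> u) - (LINT u|m. T u)\<bar> = \<bar>LINT u|m. \<phi> u - T u\<bar>"
        using int by simp
      also have "\<dots> \<le> (LINT u|m. \<bar>\<phi> u - T u\<bar>)" by (rule integral_abs_bound)
      also have "\<dots> \<le> (LINT u|m. \<delta> + 2 * B * (\<Sum>j\<in>UNIV. h (real K0) (u $ j)))"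
        using int close by (intro integral_mono) auto
      also have "\<dots> = \<delta> + 2 * B * (\<Sum>j\<in>UNIV. LINT u|m. h (real K0) (u $ j))"
        using int by (simp add: prob_space)
      finally show ?thesis .
    qed
    have ev1: "eventually (\<lambda>n. (\<Sum>j\<in>UNIV. LINT u|\<mu> n. h (real K0) (u $ j)) < \<delta> / (2 * B)) sequentially"
      by (rule order_tendstoD(2)[OF tendsto_sum[OF hconv] K0])
    have ev2: "eventually (\<lambda>n. dist (LINT u|\<mu> n. T u) (LINT u|\<nu>. T u) < \<delta>) sequentially"
      using trig_poly_integral_tendsto[OF prob sets char T] \<open>\<delta> > 0\<close> by (rule tendstoD)
    have "eventually (\<lambda>n. norm ((LINT u|\<mu> n. \<phi> u) - (LINT u|\<nu>. \<phi> u)) < e) sequentially"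
      using ev1 ev2
    proof eventually_elim
      case (elim n)
      have *: "2 * B * s < \<delta>" if "s < \<delta> / (2 * B)" for s
        using that \<open>B > 0\<close> by (simp add: field_simps)
      show ?case
        using bound[OF prob(1) sets(1), of n] bound[OF prob(2) sets(2)] *[OF elim(1)] *[OF K0] elim(2)
          \<open>\<delta> > 0\<close> e8
        unfolding dist_real_def real_norm_def by linarith
    qed
    then show "\<exists>N. \<forall>n\<ge>N. norm ((LINT u|\<mu> n. \<phi> u) - (LINT u|\<nu>. \<phi> u)) < e"
      by (simp add: eventually_sequentially)
  qed
qed

section \<open>Point configurations and Poisson processes\<close>

text \<open>Unconditional convergence of real sums is absolute convergence. Sums over a
  configuration thus become integrals for counting measure, where dominated convergence is
  available.\<close>

lemma summable_on_iff_integrable_count_space: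
  fixes g :: "'b \<Rightarrow> real"
  shows "g summable_on A \<longleftrightarrow> integrable (count_space A) g"
  using summable_on_iff_abs_summable_on_real[of g A] abs_summable_equivalent[of g A]
  by (simp add: Infinite_Set_Sum.abs_summable_on_def)

lemma infsum_eq_integral_count_space:
  fixes g :: "'b \<Rightarrow> real"
  assumes "integrable (count_space A) g"
  shows "infsum g A = integral\<^sup>L (count_space A) g"
  using infsetsum_infsum[of g A] assms
  by (simp add: Infinite_Set_Sum.abs_summable_on_def infsetsum_def)

text \<open>No law is prescribed here: the projected process \<open>X_eps\<close> is an instance as
  well, and its law is never identified.\<close>

locale point_config =
  fixes M :: "'a measure" and P :: "'a \<Rightarrow> ('b::metric_space) set"
  assumes finite_bounded: "\<omega> \<in> space M \<Longrightarrow> bounded B \<Longrightarrow> finite (P \<omega> \<inter> B)"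
    and card_measurable: "A \<in> sets borel \<Longrightarrow> bounded A \<Longrightarrow>
      (\<lambda>\<omega>. real (card (P \<omega> \<inter> A))) \<in> borel_measurable M"
begin

lemma nn_integral_indicator_bounded:
  assumes "\<omega> \<in> space M" "bounded B"
  shows "(\<integral>\<^sup>+p. indicator B p \<partial>count_space (P \<omega>)) = ennreal (real (card (P \<omega> \<inter> B)))"
proof -
  have "(\<integral>\<^sup>+p. indicator B p \<partial>count_space (P \<omega>)) = (\<Sum>p\<in>P \<omega> \<inter> B. indicator B p)"
    using finite_bounded[OF assms] by (intro nn_integral_count_space') auto
  then show ?thesis by (simp add: ennreal_of_nat_eq_real_of_nat)
qed

text \<open>Counts are controlled on bounded sets only, so a general set is exhausted by balls;
  \<open>undefined\<close> serves as an arbitrary fixed centre.\<close>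

lemma nn_integral_indicator_SUP:
  "(\<integral>\<^sup>+p. indicator A p \<partial>count_space (P \<omega>)) =
   (SUP n. \<integral>\<^sup>+p. indicator (A \<inter> cball undefined (real n)) p \<partial>count_space (P \<omega>))"
proof -
  have "(SUP n. indicator (A \<inter> cball undefined (real n)) p) = (indicator A p :: ennreal)" for p
  proof (rule antisym[OF SUP_least])
    obtain n :: nat where "dist undefined p \<le> real n" using real_arch_simple by blast
    then show "indicator A p \<le> (SUP n. indicator (A \<inter> cball undefined (real n)) p :: ennreal)"
      by (intro SUP_upper2[of n]) (auto split: split_indicator)
  qed (auto split: split_indicator)
  moreover have "incseq (\<lambda>n p. indicator (A \<inter> cball undefined (real n)) p :: ennreal)"
    by (auto simp: incseq_def le_fun_def split: split_indicator)
  ultimately show ?thesis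
    by (subst nn_integral_monotone_convergence_SUP[symmetric]) auto
qed

lemma nn_integral_count_space_measurable [measurable]:
  assumes "g \<in> borel_measurable borel"
  shows "(\<lambda>\<omega>. \<integral>\<^sup>+p. g p \<partial>count_space (P \<omega>)) \<in> borel_measurable M"
  using assms
proof (induction rule: borel_measurable_induct)
  case (cong f g)
  then have "f = g" by auto
  then show ?case using cong by simp
next
  case (set A)
  have "(\<lambda>\<omega>. \<integral>\<^sup>+p. indicator (A \<inter> cball undefined (real n)) p \<partial>count_space (P \<omega>))
      \<in> borel_measurable M" for n
  proof -
    have "bounded (A \<inter> cball undefined (real n))" "A \<inter> cball undefined (real n) \<in> sets borel"
      using set by (auto intro: bounded_subset[OF bounded_cball])
    then have "(\<lambda>\<omega>. ennreal (real (card (P \<omega> \<inter> (A \<inter> cball undefined (real n)))))) \<in> borel_measurable M"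
      by (intro measurable_compose[OF card_measurable measurable_ennreal])
    then show ?thesis
      by (rule measurable_cong[THEN iffD1, rotated])
         (simp add: nn_integral_indicator_bounded \<open>bounded _\<close>)
  qed
  then show ?case
    by (subst nn_integral_indicator_SUP) (rule borel_measurable_SUP, auto)
next
  case (mult u c)
  then show ?case by (simp add: nn_integral_cmult)
next
  case (add u v)
  then show ?case by (simp add: nn_integral_add)
next
  case (seq U)
  have "(SUP i. U i) = (\<lambda>p. SUP i. U i p)" by (auto simp: fun_eq_iff image_comp)
  then have "(\<lambda>\<omega>. \<integral>\<^sup>+p. (SUP i. U i) p \<partial>count_space (P \<omega>)) =
      (\<lambda>\<omega>. SUP i. \<integral>\<^sup>+p. U i p \<partial>count_space (P \<omega>))"
    using seq by (simp only:) (subst nn_integral_monotone_convergence_SUP, auto)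
  with seq show ?case by simp
qed

lemma infsum_measurable [measurable]:
  fixes g :: "'b \<Rightarrow> real"
  assumes [measurable]: "g \<in> borel_measurable borel"
  shows "(\<lambda>\<omega>. infsum g (P \<omega>)) \<in> borel_measurable M"
proof -
  \<comment> \<open>\<open>infsum\<close> is 0 when there is no absolute convergence, so the branch
    makes the formula valid for every outcome and not just almost surely.\<close>
  have "infsum g (P \<omega>) = (if (\<integral>\<^sup>+p. ennreal \<bar>g p\<bar> \<partial>count_space (P \<omega>)) < \<infinity>
     then enn2real (\<integral>\<^sup>+p. ennreal (g p) \<partial>count_space (P \<omega>)) -
          enn2real (\<integral>\<^sup>+p. ennreal (- g p) \<partial>count_space (P \<omega>)) else 0)" for \<omega>
    using infsum_eq_integral_count_space[of "P \<omega>" g] infsum_not_exists[of g "P \<omega>"]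
      real_lebesgue_integral_def[of "count_space (P \<omega>)" g]
    by (auto simp: summable_on_iff_integrable_count_space integrable_iff_bounded)
  then show ?thesis by simp
qed

end

section \<open>Poisson random variables\<close>

lemma poisson_distr_eq:
  fixes N :: "'a \<Rightarrow> nat"
  assumes "prob_space M" and [measurable]: "N \<in> measurable M (count_space UNIV)"
    and P: "\<And>k. measure M {\<omega> \<in> space M. N \<omega> = k} = l ^ k / fact k * exp (- l)"
  shows "distr M (count_space UNIV) N =
    density (count_space UNIV) (\<lambda>k. ennreal (l ^ k / fact k * exp (- l)))"
proof (rule measure_eqI_countable[of _ UNIV])
  interpret prob_space M by fact
  fix k :: nat
  have "N -` {k} \<inter> space M = {\<omega> \<in> space M. N \<omega> = k}" by auto
  then show "emeasure (distr M (count_space UNIV) N) {k} =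
    emeasure (density (count_space UNIV) (\<lambda>k. ennreal (l ^ k / fact k * exp (- l)))) {k}"
    using P[of k]
    by (simp add: emeasure_distr emeasure_density emeasure_eq_measure nn_integral_count_space'[of "{k}"])
qed auto

lemma poisson_char:
  fixes N :: "'a \<Rightarrow> nat"
  assumes "prob_space M" and [measurable]: "N \<in> measurable M (count_space UNIV)" and "0 \<le> l"
    and P: "\<And>k. measure M {\<omega> \<in> space M. N \<omega> = k} = l ^ k / fact k * exp (- l)"
  shows "(CLINT \<omega>|M. iexp (c * real (N \<omega>))) = exp (of_real l * (iexp c - 1))"
proof -
  interpret prob_space M by fact
  interpret D: prob_space "distr M (count_space UNIV) N" by (rule prob_space_distr) simp
  let ?p = "\<lambda>k. l ^ k / fact k * exp (- l)"
  let ?f = "\<lambda>k :: nat. iexp (c * real k)"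
  note eq = poisson_distr_eq[OF assms(1,2) P]
  have "integrable (distr M (count_space UNIV) N) ?f"
    by (rule D.integrable_const_bound[where B=1]) auto
  then have "integrable (count_space UNIV) (\<lambda>k. ?p k *\<^sub>R ?f k)"
    unfolding eq using \<open>0 \<le> l\<close> by (subst (asm) integrable_density) auto
  then have "(\<lambda>k. ?p k *\<^sub>R ?f k) sums (integral\<^sup>L (count_space UNIV) (\<lambda>k. ?p k *\<^sub>R ?f k))"
    by (rule sums_integral_count_space_nat)
  moreover have "(\<lambda>k. ?p k *\<^sub>R ?f k) sums (exp (of_real l * iexp c) * exp (- of_real l))"
  proof -
    have "(\<lambda>k. ((of_real l * iexp c) ^ k /\<^sub>R fact k) * exp (- of_real l)) sums
        (exp (of_real l * iexp c) * exp (- of_real l))"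
      by (intro sums_mult2 exp_converges)
    moreover have "((of_real l * iexp c) ^ k /\<^sub>R fact k) * exp (- of_real l) = ?p k *\<^sub>R ?f k" for k
    proof -
      have "?f k = iexp c ^ k"
        by (simp add: exp_of_nat_mult[symmetric] mult_ac)
      then show ?thesis
        by (simp add: power_mult_distrib scaleR_conv_of_real exp_of_real[symmetric] field_simps)
    qed
    ultimately show ?thesis by simp
  qed
  ultimately have "integral\<^sup>L (count_space UNIV) (\<lambda>k. ?p k *\<^sub>R ?f k) =
      exp (of_real l * iexp c) * exp (- of_real l)"
    by (rule sums_unique2)
  moreover have "(CLINT \<omega>|M. iexp (c * real (N \<omega>))) = integral\<^sup>L (distr M (count_space UNIV) N) ?f"
    by (subst integral_distr) auto
  moreover have "\<dots> = integral\<^sup>L (count_space UNIV) (\<lambda>k. ?p k *\<^sub>R ?f k)"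
    unfolding eq using \<open>0 \<le> l\<close> by (subst integral_density) auto
  ultimately show ?thesis
    by (simp add: exp_add[symmetric] right_diff_distrib)
qed

lemma poisson_expectation:
  fixes N :: "'a \<Rightarrow> nat"
  assumes "prob_space M" and [measurable]: "N \<in> measurable M (count_space UNIV)" and "0 \<le> l"
    and P: "\<And>k. measure M {\<omega> \<in> space M. N \<omega> = k} = l ^ k / fact k * exp (- l)"
  shows "(\<integral>\<^sup>+\<omega>. ennreal (real (N \<omega>)) \<partial>M) = ennreal l"
proof -
  let ?p = "\<lambda>k. l ^ k / fact k * exp (- l)"
  \<comment> \<open>The weight at k + 1 times k + 1 is \<open>l\<close> times the weight at k; the
    term at 0 vanishes, so shifting the index back adds nothing.\<close>
  have "(\<lambda>k. (l ^ k /\<^sub>R fact k) * (l * exp (- l))) sums (exp l * (l * exp (- l)))"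
    by (intro sums_mult2 exp_converges)
  moreover have "(l ^ k /\<^sub>R fact k) * (l * exp (- l)) = ?p (Suc k) * real (Suc k)" for k
    by (simp add: field_simps del: of_nat_Suc)
  moreover have "exp l * (l * exp (- l)) = l" by (simp add: exp_minus field_simps)
  ultimately have "(\<lambda>k. ?p (Suc k) * real (Suc k)) sums l" by simp
  then have "(\<lambda>k. ?p k * real k) sums l"
    using sums_Suc[of "\<lambda>k. ?p k * real k" l] by simp
  then have "(\<Sum>k. ennreal (?p k * real k)) = ennreal l"
    using \<open>0 \<le> l\<close> by (intro suminf_ennreal_eq) auto
  moreover have "(\<integral>\<^sup>+\<omega>. ennreal (real (N \<omega>)) \<partial>M) =
      (\<integral>\<^sup>+k. ennreal (real k) \<partial>distr M (count_space UNIV) N)"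
    by (subst nn_integral_distr) auto
  moreover have "\<dots> = (\<Sum>k. ennreal (?p k * real k))"
    unfolding poisson_distr_eq[OF assms(1,2) P]
    using \<open>0 \<le> l\<close>
    by (subst nn_integral_density) (auto simp: nn_integral_count_space_nat ennreal_mult[symmetric])
  ultimately show ?thesis by simp
qed

section \<open>Campbell's formula and the characteristic functional\<close>

locale poisson_process =
  fixes M :: "'a measure" and \<Lambda> :: "('b::metric_space) measure" and X :: "'a \<Rightarrow> 'b set"
  assumes ppp: "poisson_point_process M \<Lambda> X"
    and finite_intensity: "A \<in> sets borel \<Longrightarrow> bounded A \<Longrightarrow> emeasure \<Lambda> A < \<infinity>"
begin

sublocale prob_space M
  using ppp by (simp add: poisson_point_process_def)

lemma sets_intensity [measurable_cong, simp]: "sets \<Lambda> = sets borel"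
  using ppp by (simp add: poisson_point_process_def)

lemma space_intensity [simp]: "space \<Lambda> = UNIV"
  using sets_eq_imp_space_eq[OF sets_intensity] by simp

lemma card_measurable_nat:
  "A \<in> sets borel \<Longrightarrow> bounded A \<Longrightarrow> (\<lambda>\<omega>. card (X \<omega> \<inter> A)) \<in> measurable M (count_space UNIV)"
  using ppp by (simp add: poisson_point_process_def)

sublocale point_config M X
proof
  show "finite (X \<omega> \<inter> B)" if "\<omega> \<in> space M" "bounded B" for \<omega> B
    using ppp that by (simp add: poisson_point_process_def)
  show "(\<lambda>\<omega>. real (card (X \<omega> \<inter> A))) \<in> borel_measurable M" if "A \<in> sets borel" "bounded A" for A
    using card_measurable_nat[OF that] by simp
qed

lemma card_indep:
  assumes "finite (I :: nat set)" "\<And>i. i \<in> I \<Longrightarrow> A i \<in> sets borel" "\<And>i. i \<in> I \<Longrightarrow> bounded (A i)"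
    "disjoint_family_on A I"
  shows "indep_vars (\<lambda>_. count_space UNIV) (\<lambda>i \<omega>. card (X \<omega> \<inter> A i)) I"
  using ppp assms finite_intensity by (auto simp: poisson_point_process_def)

lemma card_distr:
  assumes "A \<in> sets borel" "bounded A"
  shows "prob {\<omega> \<in> space M. card (X \<omega> \<inter> A) = k} =
    measure \<Lambda> A ^ k / fact k * exp (- measure \<Lambda> A)"
proof -
  have *: "\<forall>(I::nat set) A. finite I \<longrightarrow>
        (\<forall>i\<in>I. A i \<in> sets borel \<and> bounded (A i) \<and> emeasure \<Lambda> (A i) < \<infinity>) \<longrightarrow>
        disjoint_family_on A I \<longrightarrow>
        (\<forall>i\<in>I. \<forall>k::nat. measure M {\<omega>\<in>space M. card (X \<omega> \<inter> A i) = k} =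
              measure \<Lambda> (A i) ^ k / fact k * exp (- measure \<Lambda> (A i)))"
    using ppp unfolding poisson_point_process_def by blast
  show ?thesis
    using *[THEN spec[of _ "{0}"], THEN spec[of _ "\<lambda>_. A"]] assms finite_intensity[OF assms]
    by (simp add: disjoint_family_on_def)
qed

text \<open>For the indicator of a bounded set this is the mean of a Poisson variable; exhaustion by
  balls and monotone approximation extend it to all nonnegative Borel functions.\<close>

lemma campbell:
  assumes "g \<in> borel_measurable borel"
  shows "(\<integral>\<^sup>+\<omega>. (\<integral>\<^sup>+p. g p \<partial>count_space (X \<omega>)) \<partial>M) = (\<integral>\<^sup>+p. g p \<partial>\<Lambda>)"
  using assms
proof (induction rule: borel_measurable_induct)
  case (cong f g)
  then have "f = g" by auto
  then show ?case using cong by simp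
next
  case (set A)
  let ?A = "\<lambda>n. A \<inter> cball undefined (real n)"
  have A: "?A n \<in> sets borel" "bounded (?A n)" for n
    using set by (auto intro: bounded_subset[OF bounded_cball])
  have E: "(\<integral>\<^sup>+\<omega>. (\<integral>\<^sup>+p. indicator (?A n) p \<partial>count_space (X \<omega>)) \<partial>M) = emeasure \<Lambda> (?A n)" for n
  proof -
    have "(\<integral>\<^sup>+\<omega>. (\<integral>\<^sup>+p. indicator (?A n) p \<partial>count_space (X \<omega>)) \<partial>M) =
      (\<integral>\<^sup>+\<omega>. ennreal (real (card (X \<omega> \<inter> ?A n))) \<partial>M)"
      by (intro nn_integral_cong nn_integral_indicator_bounded A)
    also have "\<dots> = ennreal (measure \<Lambda> (?A n))"
      by (intro poisson_expectation card_measurable_nat card_distr A prob_space_axioms) simp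
    also have "\<dots> = emeasure \<Lambda> (?A n)"
      using finite_intensity[OF A(1)[of n] A(2)[of n]] by (intro emeasure_eq_ennreal_measure[symmetric]) auto
    finally show ?thesis .
  qed
  have "(\<integral>\<^sup>+\<omega>. (\<integral>\<^sup>+p. indicator A p \<partial>count_space (X \<omega>)) \<partial>M) =
     (SUP n. \<integral>\<^sup>+\<omega>. (\<integral>\<^sup>+p. indicator (?A n) p \<partial>count_space (X \<omega>)) \<partial>M)"
    unfolding nn_integral_indicator_SUP[where A=A]
  proof (rule nn_integral_monotone_convergence_SUP)
    show "incseq (\<lambda>n \<omega>. \<integral>\<^sup>+p. indicator (?A n) p \<partial>count_space (X \<omega>))"
      by (auto simp: incseq_def le_fun_def intro!: nn_integral_mono split: split_indicator)
  qed (use A in measurable)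
  also have "\<dots> = (SUP n. emeasure \<Lambda> (?A n))"
    by (simp only: E)
  also have "(SUP n. emeasure \<Lambda> (?A n)) = emeasure \<Lambda> (\<Union>n. ?A n)"
    using A by (intro SUP_emeasure_incseq) (auto simp: incseq_def)
  also have "(\<Union>n. ?A n) = A"
    using real_arch_simple by auto
  finally show ?case using set by simp
next
  case (mult u c)
  then show ?case by (simp add: nn_integral_cmult)
next
  case (add u v)
  then show ?case by (simp add: nn_integral_add)
next
  case (seq U)
  have inc: "incseq (\<lambda>i \<omega>. \<integral>\<^sup>+p. U i p \<partial>count_space (X \<omega>))"
    using \<open>incseq U\<close> by (auto simp: incseq_def le_fun_def intro!: nn_integral_mono)
  have sup: "(SUP i. U i) = (\<lambda>p. SUP i. U i p)" by (auto simp: fun_eq_iff image_comp)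
  have "(\<integral>\<^sup>+\<omega>. (\<integral>\<^sup>+p. (SUP i. U i) p \<partial>count_space (X \<omega>)) \<partial>M) =
    (\<integral>\<^sup>+\<omega>. (SUP i. \<integral>\<^sup>+p. U i p \<partial>count_space (X \<omega>)) \<partial>M)"
    unfolding sup using seq by (subst nn_integral_monotone_convergence_SUP) auto
  also have "\<dots> = (SUP i. \<integral>\<^sup>+\<omega>. (\<integral>\<^sup>+p. U i p \<partial>count_space (X \<omega>)) \<partial>M)"
    using seq by (intro nn_integral_monotone_convergence_SUP inc) auto
  also have "\<dots> = (\<integral>\<^sup>+p. (SUP i. U i) p \<partial>\<Lambda>)"
    unfolding sup using seq by (subst nn_integral_monotone_convergence_SUP) auto
  finally show ?case .
qed

text \<open>Campbell's formula gives the sum of the absolute values a finite mean, so it is finite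
  almost surely.\<close>

lemma AE_integrable_count_space:
  fixes g :: "'b \<Rightarrow> real"
  assumes "integrable \<Lambda> g"
  shows "AE \<omega> in M. integrable (count_space (X \<omega>)) g"
proof -
  have [measurable]: "g \<in> borel_measurable borel"
    using assms by (simp add: integrable_iff_bounded measurable_cong_sets[OF sets_intensity refl])
  have "(\<integral>\<^sup>+\<omega>. (\<integral>\<^sup>+p. ennreal \<bar>g p\<bar> \<partial>count_space (X \<omega>)) \<partial>M) \<noteq> \<infinity>"
    using assms by (subst campbell) (auto simp: integrable_iff_bounded)
  then have "AE \<omega> in M. (\<integral>\<^sup>+p. ennreal \<bar>g p\<bar> \<partial>count_space (X \<omega>)) \<noteq> \<infinity>"
    by (intro nn_integral_PInf_AE) auto
  then show ?thesis
    by eventually_elim (auto simp: integrable_iff_bounded less_top)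
qed

text \<open>The sum over the configuration is a linear combination of counts in finitely many
  disjoint bounded cells. These counts are independent Poisson variables, so the characteristic
  function factorizes.\<close>

lemma char_functional_simple:
  fixes g :: "'b \<Rightarrow> real"
  assumes g: "simple_function borel g" and B: "B \<in> sets borel" "bounded B"
    and supp: "\<And>p. p \<notin> B \<Longrightarrow> g p = 0"
  shows "(CLINT \<omega>|M. iexp (infsum g (X \<omega>))) = exp (CLINT p|\<Lambda>. iexp (g p) - 1)"
proof -
  have [measurable]: "g \<in> borel_measurable borel" using g by (rule borel_measurable_simple_function)
  have "finite (range g)" using g by (simp add: simple_function_def)
  define n where "n = card (range g)"
  obtain h where h: "bij_betw h {..<n} (range g)"
    using ex_bij_betw_nat_finite[OF \<open>finite (range g)\<close>] by (auto simp: atLeast0LessThan n_def)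
  \<comment> \<open>Cutting with \<open>B\<close> keeps the level set of 0 bounded; that level
    contributes the factor 1.\<close>
  define A where "A i = B \<inter> g -` {h i}" for i
  have A: "A i \<in> sets borel" "bounded (A i)" for i
    using B measurable_sets[of g borel borel "{h i}"]
    by (auto simp: A_def intro: bounded_subset)
  have inj: "inj_on h {..<n}" using h by (simp add: bij_betw_def)
  have disj: "disjoint_family_on A {..<n}"
    using inj by (auto simp: disjoint_family_on_def A_def inj_on_def)
  have pick: "\<exists>k<n. h k = g p \<and> (\<forall>i<n. p \<in> A i \<longleftrightarrow> i = k)"
    if "p \<in> B" for p
  proof -
    obtain k where k: "k < n" "h k = g p"
      using h by (metis bij_betw_iff_bijections lessThan_iff rangeI)
    then show ?thesis
      using inj \<open>p \<in> B\<close> by (intro exI[of _ k]) (auto simp: A_def inj_on_def)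
  qed
  have lam: "emeasure \<Lambda> (A i) < \<infinity>" for i by (intro finite_intensity A)
  have infsum_eq: "infsum g (X \<omega>) = (\<Sum>i<n. h i * real (card (X \<omega> \<inter> A i)))" if "\<omega> \<in> space M" for \<omega>
  proof -
    have fin: "finite (X \<omega> \<inter> B)" using that B by (simp add: finite_bounded)
    have "infsum g (X \<omega>) = infsum g (X \<omega> \<inter> B)"
      by (rule infsum_cong_neutral) (auto simp: supp)
    also have "\<dots> = (\<Sum>p\<in>X \<omega> \<inter> B. \<Sum>i<n. indicator (A i) p *\<^sub>R h i)"
    proof -
      have "(\<Sum>i<n. indicator (A i) p *\<^sub>R h i) = g p" if p: "p \<in> B" for p
      proof -
        obtain k where k: "k < n" "h k = g p" "\<forall>i<n. p \<in> A i \<longleftrightarrow> i = k" using pick[OF p] by auto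
        have "(\<Sum>i<n. indicator (A i) p *\<^sub>R h i) = (\<Sum>i<n. if i = k then h k else 0)"
          by (intro sum.cong) (auto simp: k)
        with k show ?thesis by simp
      qed
      with fin show ?thesis by simp
    qed
    also have "\<dots> = (\<Sum>i<n. \<Sum>p\<in>X \<omega> \<inter> B. indicator (A i) p *\<^sub>R h i)"
      by (rule sum.swap)
    also have "\<dots> = (\<Sum>i<n. h i * real (card (X \<omega> \<inter> A i)))"
    proof (rule sum.cong)
      fix i
      have "X \<omega> \<inter> B \<inter> A i = X \<omega> \<inter> A i" by (auto simp: A_def)
      moreover have "(\<Sum>p\<in>X \<omega> \<inter> B. indicator (A i) p *\<^sub>R h i) = (\<Sum>p\<in>X \<omega> \<inter> B \<inter> A i. h i)"
        using fin by (intro sum.mono_neutral_cong_right) auto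
      ultimately show "(\<Sum>p\<in>X \<omega> \<inter> B. indicator (A i) p *\<^sub>R h i) = h i * real (card (X \<omega> \<inter> A i))"
        by simp
    qed simp
    finally show ?thesis .
  qed
  have "(CLINT \<omega>|M. iexp (infsum g (X \<omega>))) =
      (CLINT \<omega>|M. \<Prod>i<n. iexp (h i * real (card (X \<omega> \<inter> A i))))"
    by (intro Bochner_Integration.integral_cong refl)
       (simp add: infsum_eq exp_sum[symmetric] sum_distrib_left)
  also have "\<dots> = (\<Prod>i<n. CLINT \<omega>|M. iexp (h i * real (card (X \<omega> \<inter> A i))))"
  proof (rule indep_vars_lebesgue_integral)
    show "indep_vars (\<lambda>_. borel) (\<lambda>i \<omega>. iexp (h i * real (card (X \<omega> \<inter> A i)))) {..<n}"
      by (rule indep_vars_compose2[OF card_indep]) (auto intro: A disj)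
    show "integrable M (\<lambda>\<omega>. iexp (h i * real (card (X \<omega> \<inter> A i))))" for i
      using card_measurable_nat[OF A(1)[of i] A(2)[of i]] by (intro integrable_const_bound[where B=1]) auto
  qed simp
  also have "\<dots> = (\<Prod>i<n. exp (of_real (measure \<Lambda> (A i)) * (iexp (h i) - 1)))"
    by (intro prod.cong refl poisson_char card_measurable_nat card_distr A prob_space_axioms) simp
  also have "\<dots> = exp (\<Sum>i<n. of_real (measure \<Lambda> (A i)) * (iexp (h i) - 1))"
    by (simp add: exp_sum)
  also have "(\<Sum>i<n. of_real (measure \<Lambda> (A i)) * (iexp (h i) - 1)) =
      (CLINT p|\<Lambda>. \<Sum>i<n. indicator (A i) p *\<^sub>R (iexp (h i) - 1))"
    using A lam
    by (subst Bochner_Integration.integral_sum)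
       (auto simp: scaleR_conv_of_real intro!: integrable_real_indicator)
  also have "\<dots> = (CLINT p|\<Lambda>. iexp (g p) - 1)"
  proof (rule Bochner_Integration.integral_cong)
    show "(\<Sum>i<n. indicator (A i) p *\<^sub>R (iexp (h i) - 1)) = iexp (g p) - 1" for p
    proof (cases "p \<in> B")
      case True
      then obtain k where k: "k < n" "h k = g p" "\<forall>i<n. p \<in> A i \<longleftrightarrow> i = k"
        using pick by auto
      have "(\<Sum>i<n. indicator (A i) p *\<^sub>R (iexp (h i) - 1)) = (\<Sum>i<n. if i = k then iexp (h k) - 1 else 0)"
        by (intro sum.cong) (auto simp: k)
      with k show ?thesis by simp
    next
      case False
      then have "\<And>i. p \<notin> A i" by (auto simp: A_def)
      then show ?thesis using supp[OF False] by simp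
    qed
  qed simp
  finally show ?thesis .
qed

text \<open>Simple functions truncated to growing balls stay below \<open>2 * \<bar>g\<bar>\<close>.
  Domination works configuration by configuration on the left, then under the expectation, and on
  the right because |exp(i x) - 1| is at most |x|.\<close>

theorem char_functional:
  fixes g :: "'b \<Rightarrow> real"
  assumes int: "integrable \<Lambda> g"
  shows "(CLINT \<omega>|M. iexp (infsum g (X \<omega>))) = exp (CLINT p|\<Lambda>. iexp (g p) - 1)"
proof -
  have g [measurable]: "g \<in> borel_measurable borel"
    using int by (simp add: integrable_iff_bounded measurable_cong_sets[OF sets_intensity refl])
  obtain F where F: "\<And>i. simple_function borel (F i)" "\<And>p. (\<lambda>i. F i p) \<longlonglongrightarrow> g p"
      "\<And>i p. \<bar>F i p\<bar> \<le> 2 * \<bar>g p\<bar>"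
    \<comment> \<open>The base point 0 turns the distance bound of the approximating sequence into
      the factor 2 in the majorant.\<close>
    using borel_measurable_implies_sequence_metric[OF g, of 0] by auto
  define G where "G i p = F i p * indicator (cball undefined (real i)) p" for i p
  have G: "simple_function borel (G i)" for i
    unfolding G_def using F(1) by (intro simple_function_mult simple_function_indicator) auto
  then have [measurable]: "G i \<in> borel_measurable borel" for i
    by (rule borel_measurable_simple_function)
  have G_le: "\<bar>G i p\<bar> \<le> 2 * \<bar>g p\<bar>" for i p
    using F(3)[of i p] by (auto simp: G_def indicator_def)
  have G_lim: "(\<lambda>i. G i p) \<longlonglongrightarrow> g p" for p
  proof (rule Lim_transform_eventually[OF F(2)])
    obtain N :: nat where "dist undefined p \<le> real N" using real_arch_simple by blast
    then show "\<forall>\<^sub>F i in sequentially. F i p = G i p"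
      by (intro eventually_sequentiallyI[of N]) (auto simp: G_def)
  qed
  have lim1: "(\<lambda>i. CLINT \<omega>|M. iexp (infsum (G i) (X \<omega>))) \<longlonglongrightarrow> (CLINT \<omega>|M. iexp (infsum g (X \<omega>)))"
  proof (rule integral_dominated_convergence[where w="\<lambda>_. 1"])
    show "AE \<omega> in M. (\<lambda>i. iexp (infsum (G i) (X \<omega>))) \<longlonglongrightarrow> iexp (infsum g (X \<omega>))"
      using AE_integrable_count_space[OF int]
    proof eventually_elim
      case (elim \<omega>)
      have intG: "integrable (count_space (X \<omega>)) (G i)" for i
        by (rule Bochner_Integration.integrable_bound[OF integrable_mult_right[OF integrable_abs[OF elim], of 2]])
           (use G_le in auto)
      have "(\<lambda>i. integral\<^sup>L (count_space (X \<omega>)) (G i)) \<longlonglongrightarrow> integral\<^sup>L (count_space (X \<omega>)) g"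
        by (rule integral_dominated_convergence[where w="\<lambda>p. 2 * \<bar>g p\<bar>"])
           (use elim G_le G_lim in auto)
      then have "(\<lambda>i. infsum (G i) (X \<omega>)) \<longlonglongrightarrow> infsum g (X \<omega>)"
        using elim intG by (simp add: infsum_eq_integral_count_space)
      then show ?case by (intro tendsto_intros)
    qed
  qed (auto simp: norm_exp_i_times)
  have "(\<lambda>i. CLINT p|\<Lambda>. iexp (G i p) - 1) \<longlonglongrightarrow> (CLINT p|\<Lambda>. iexp (g p) - 1)"
  proof (rule integral_dominated_convergence[where w="\<lambda>p. 2 * \<bar>g p\<bar>"])
    show "AE p in \<Lambda>. (\<lambda>i. iexp (G i p) - 1) \<longlonglongrightarrow> iexp (g p) - 1"
      by (intro AE_I2 tendsto_intros G_lim)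
    show "AE p in \<Lambda>. cmod (iexp (G i p) - 1) \<le> 2 * \<bar>g p\<bar>" for i
      using iexp_approx1[of "G i _" 0] G_le by (auto intro!: AE_I2 intro: order_trans)
  qed (use int in auto)
  then have lim2: "(\<lambda>i. exp (CLINT p|\<Lambda>. iexp (G i p) - 1)) \<longlonglongrightarrow> exp (CLINT p|\<Lambda>. iexp (g p) - 1)"
    by (intro tendsto_intros)
  have eq: "(CLINT \<omega>|M. iexp (infsum (G i) (X \<omega>))) = exp (CLINT p|\<Lambda>. iexp (G i p) - 1)" for i
    by (rule char_functional_simple[OF G, of "cball undefined (real i)"]) (auto simp: G_def)
  show ?thesis
    by (rule LIMSEQ_unique[OF lim1[unfolded eq] lim2])
qed

end

section \<open>Projections of point configurations\<close>

text \<open>An enumerated countable base of a T1 space. Recording membership in its first n sets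
  gives each point a finite code, and distinct points eventually get distinct codes.\<close>

lemma countable_separating_open_sets:
  obtains B :: "nat \<Rightarrow> ('c::{t1_space, second_countable_topology}) set"
  where "\<And>i. open (B i)" "\<And>x y. x \<noteq> y \<Longrightarrow> \<exists>i. x \<in> B i \<and> y \<notin> B i"
proof -
  obtain \<B> :: "'c set set" where \<B>: "countable \<B>" "topological_basis \<B>"
    using ex_countable_basis by blast
  \<comment> \<open>A basic set inside the whole space shows that the base is nonempty, as
    \<open>from_nat_into\<close> requires.\<close>
  obtain V0 where "V0 \<in> \<B>"
    using \<B>(2) by (rule topological_basisE[OF _ open_UNIV UNIV_I])
  then have ne: "\<B> \<noteq> {}" by auto
  show ?thesis
  proof (rule that[of "from_nat_into \<B>"])
    show "open (from_nat_into \<B> i)" for i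
      using topological_basis_open[OF \<B>(2) from_nat_into[OF ne]] .
    show "\<exists>i. x \<in> from_nat_into \<B> i \<and> y \<notin> from_nat_into \<B> i" if "x \<noteq> y" for x y
    proof -
      obtain U where U: "open U" "x \<in> U" "y \<notin> U" using t1_space \<open>x \<noteq> y\<close> by blast
      obtain V where V: "V \<in> \<B>" "x \<in> V" "V \<subseteq> U"
        using \<B>(2) U(1,2) by (rule topological_basisE)
      then obtain i where "from_nat_into \<B> i = V" using from_nat_into_surj[OF \<B>(1)] by blast
      with U V show ?thesis by blast
    qed
  qed
qed

text \<open>Each of the finitely many pairs of distinct points is told apart from some n on, so the
  coding map is eventually injective on \<open>G\<close>.\<close>

lemma card_image_separating_tendsto:
  assumes "finite G" and sep: "\<And>x y. x \<noteq> y \<Longrightarrow> \<exists>i. x \<in> B i \<and> y \<notin> B i"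
  shows "(\<lambda>n. real (card ((\<lambda>c. {i::nat. i < n \<and> c \<in> B i}) ` G))) \<longlonglongrightarrow> real (card G)"
proof (rule tendsto_eventually)
  have "\<forall>\<^sub>F n in sequentially. {i. i < n \<and> x \<in> B i} = {i. i < n \<and> y \<in> B i} \<longrightarrow> x = y" for x y
  proof (cases "x = y")
    case False
    then obtain i where i: "x \<in> B i" "y \<notin> B i" using sep by blast
    show ?thesis
    proof (intro eventually_sequentiallyI[of "Suc i"] impI)
      fix n assume "Suc i \<le> n" and eq: "{i. i < n \<and> x \<in> B i} = {i. i < n \<and> y \<in> B i}"
      have "i \<in> {i. i < n \<and> x \<in> B i}" using i \<open>Suc i \<le> n\<close> by simp
      then show "x = y" unfolding eq using i by simp
    qed
  qed simp
  then have "\<forall>\<^sub>F n in sequentially. \<forall>x\<in>G. \<forall>y\<in>G.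
      {i. i < n \<and> x \<in> B i} = {i. i < n \<and> y \<in> B i} \<longrightarrow> x = y"
    using \<open>finite G\<close> by (intro eventually_ball_finite ballI)
  then show "\<forall>\<^sub>F n in sequentially. real (card ((\<lambda>c. {i. i < n \<and> c \<in> B i}) ` G)) = real (card G)"
    by eventually_elim (simp add: card_image inj_on_def)
qed

text \<open>Points of a configuration may have the same image, so the number of image points in a set is
  obtained as the limit of the number of nonempty cells of finer and finer finite partitions.\<close>
lemma (in point_config) point_config_image:
  fixes \<pi> :: "'b \<Rightarrow> 'c::{metric_space, second_countable_topology}"
  assumes \<pi> [measurable]: "\<pi> \<in> borel_measurable borel" and D [measurable]: "D \<in> sets borel"
    and bdd: "\<And>A. bounded A \<Longrightarrow> bounded (D \<inter> \<pi> -` A)"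
  shows "point_config M (\<lambda>\<omega>. \<pi> ` (P \<omega> \<inter> D))"
proof
  have eq: "\<pi> ` (P \<omega> \<inter> D) \<inter> A = \<pi> ` (P \<omega> \<inter> (D \<inter> \<pi> -` A))" for \<omega> A by auto
  show fin: "finite (\<pi> ` (P \<omega> \<inter> D) \<inter> A)" if "\<omega> \<in> space M" "bounded A" for \<omega> A
    unfolding eq using that by (intro finite_imageI finite_bounded bdd)
  show "(\<lambda>\<omega>. real (card (\<pi> ` (P \<omega> \<inter> D) \<inter> A))) \<in> borel_measurable M"
    if A [measurable]: "A \<in> sets borel" and "bounded A" for A
  proof -
    obtain B :: "nat \<Rightarrow> 'c set" where B: "\<And>i. open (B i)" and
      sep: "\<And>x y. x \<noteq> y \<Longrightarrow> \<exists>i. x \<in> B i \<and> y \<notin> B i"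
      using countable_separating_open_sets by blast
    have [measurable]: "B i \<in> sets borel" for i using B by simp
    define q where "q n c = {i. i < n \<and> c \<in> B i}" for n c
    \<comment> \<open>The source points whose image lies in \<open>A\<close> and has code
      \<open>s\<close>: a bounded Borel set, so its count is measurable although counts of images
      are not yet known to be.\<close>
    define C where "C n s = (D \<inter> \<pi> -` A) \<inter> {b. \<forall>i<n. \<pi> b \<in> B i \<longleftrightarrow> i \<in> s}" for n :: nat and s
    have C: "C n s \<in> sets borel" "bounded (C n s)" for n s
    proof -
      have "C n s = {b \<in> space borel. b \<in> D \<and> \<pi> b \<in> A \<and> (\<forall>i\<in>{..<n}. \<pi> b \<in> B i \<longleftrightarrow> i \<in> s)}"
        by (auto simp: C_def)
      also have "\<dots> \<in> sets borel" by measurable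
      finally show "C n s \<in> sets borel" .
      show "bounded (C n s)"
        using bdd[OF \<open>bounded A\<close>] by (rule bounded_subset) (auto simp: C_def)
    qed
    have cells: "real (card (q n ` (\<pi> ` (P \<omega> \<inter> D) \<inter> A))) =
        (\<Sum>s\<in>Pow {..<n}. min 1 (real (card (P \<omega> \<inter> C n s))))" if "\<omega> \<in> space M" for \<omega> n
    proof -
      have "q n ` (\<pi> ` (P \<omega> \<inter> D) \<inter> A) = {s \<in> Pow {..<n}. P \<omega> \<inter> C n s \<noteq> {}}"
      proof (intro equalityI subsetI)
        fix s assume "s \<in> q n ` (\<pi> ` (P \<omega> \<inter> D) \<inter> A)"
        then obtain b where "b \<in> P \<omega>" "b \<in> D" "\<pi> b \<in> A" "s = q n (\<pi> b)" by auto
        then have "b \<in> P \<omega> \<inter> C n s" "s \<in> Pow {..<n}" by (auto simp: C_def q_def)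
        then show "s \<in> {s \<in> Pow {..<n}. P \<omega> \<inter> C n s \<noteq> {}}" by auto
      next
        fix s assume "s \<in> {s \<in> Pow {..<n}. P \<omega> \<inter> C n s \<noteq> {}}"
        then obtain b where b: "s \<subseteq> {..<n}" "b \<in> P \<omega>" "b \<in> C n s" by auto
        then have "s = q n (\<pi> b)" by (auto simp: C_def q_def)
        with b show "s \<in> q n ` (\<pi> ` (P \<omega> \<inter> D) \<inter> A)" by (auto simp: C_def)
      qed
      \<comment> \<open>Truncation at 1 records only whether the cell is hit, so multiplicities of
        images disappear. Finiteness matters, since \<open>card\<close> of an infinite set is
        0.\<close>
      moreover have "min 1 (real (card (P \<omega> \<inter> C n s))) = (if P \<omega> \<inter> C n s \<noteq> {} then 1 else 0)" for s
      proof (cases "P \<omega> \<inter> C n s = {}")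
        case False
        then have "card (P \<omega> \<inter> C n s) > 0"
          using finite_bounded[OF that C(2)] by (simp add: card_gt_0_iff)
        then show ?thesis using False by auto
      qed simp
      ultimately show ?thesis
        by (simp add: sum.If_cases Int_def)
    qed
    show ?thesis
    proof (rule borel_measurable_LIMSEQ_real)
      show "(\<lambda>n. real (card (q n ` (\<pi> ` (P \<omega> \<inter> D) \<inter> A)))) \<longlonglongrightarrow> real (card (\<pi> ` (P \<omega> \<inter> D) \<inter> A))"
        if "\<omega> \<in> space M" for \<omega>
        unfolding q_def using fin[OF that \<open>bounded A\<close>] sep by (rule card_image_separating_tendsto)
      show "(\<lambda>\<omega>. real (card (q n ` (\<pi> ` (P \<omega> \<inter> D) \<inter> A)))) \<in> borel_measurable M" for n
      proof -
        have "(\<lambda>\<omega>. \<Sum>s\<in>Pow {..<n}. min 1 (real (card (P \<omega> \<inter> C n s)))) \<in> borel_measurable M"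
          by (intro borel_measurable_sum borel_measurable_min card_measurable C) simp
        then show ?thesis
          by (rule measurable_cong[THEN iffD1, rotated]) (simp add: cells)
      qed
    qed
  qed
qed

section \<open>Integration over the auxiliary fourth coordinate\<close>

lemma nn_integral_lborel_prod:
  fixes F :: "'a::euclidean_space \<times> 'b::euclidean_space \<Rightarrow> ennreal"
  assumes [measurable]: "F \<in> borel_measurable borel"
  shows "(\<integral>\<^sup>+p. F p \<partial>lborel) = (\<integral>\<^sup>+x. \<integral>\<^sup>+y. F (x, y) \<partial>lborel \<partial>lborel)"
proof -
  have [measurable]: "F \<in> borel_measurable (lborel \<Otimes>\<^sub>M lborel)" by (simp add: lborel_prod)
  show ?thesis
    by (simp add: lborel_prod[symmetric] lborel.nn_integral_fst)
qed

lemma borel_measurable_Pair1: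
  fixes H :: "'a::euclidean_space \<times> 'b::euclidean_space \<Rightarrow> ennreal"
  assumes "H \<in> borel_measurable borel"
  shows "(\<lambda>y. H (x, y)) \<in> borel_measurable borel"
  by (rule measurable_compose[OF borel_measurable_continuous_onI assms]) (intro continuous_intros)

text \<open>Written with selectors instead of pattern matching, so that continuity, and with it
  measurability, follows from the standard rules.\<close>

definition proj3 :: "real \<times> real \<times> real \<times> real \<Rightarrow> real \<times> real \<times> real" where
  "proj3 q = (fst q, fst (snd q), fst (snd (snd q)))"

definition zcoord :: "real \<times> real \<times> real \<times> real \<Rightarrow> real" where
  "zcoord q = snd (snd (snd q))"

lemma proj3_measurable [measurable]: "proj3 \<in> borel_measurable borel"
  unfolding proj3_def by (intro borel_measurable_continuous_onI continuous_intros)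

lemma zcoord_measurable [measurable]: "zcoord \<in> borel_measurable borel"
  unfolding zcoord_def by (intro borel_measurable_continuous_onI continuous_intros)

text \<open>Tonelli with the fourth coordinate innermost. For \<open>J\<close> the interval from 0
  to 1/eps its length is the factor 1/eps in the thinned intensity.\<close>

lemma nn_integral_proj3_zcoord:
  assumes [measurable]: "F \<in> borel_measurable borel" "J \<in> sets borel"
  shows "(\<integral>\<^sup>+q. F (proj3 q) * indicator J (zcoord q) \<partial>lborel) =
    emeasure lborel J * (\<integral>\<^sup>+p. F p \<partial>lborel)"
proof -
  let ?H = "\<lambda>q. F (proj3 q) * indicator J (zcoord q)"
  have H: "?H \<in> borel_measurable borel" by measurable
  note H1 = borel_measurable_Pair1[OF H] note H2 = borel_measurable_Pair1[OF H1]
  have "integral\<^sup>N lborel ?H =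
      (\<integral>\<^sup>+x. \<integral>\<^sup>+v. \<integral>\<^sup>+r. \<integral>\<^sup>+z. F (x, v, r) * indicator J z \<partial>lborel \<partial>lborel \<partial>lborel \<partial>lborel)"
    unfolding nn_integral_lborel_prod[OF H] nn_integral_lborel_prod[OF H1]
      nn_integral_lborel_prod[OF H2]
    by (simp add: proj3_def zcoord_def)
  also have "\<dots> = (\<integral>\<^sup>+x. \<integral>\<^sup>+v. \<integral>\<^sup>+r. F (x, v, r) * emeasure lborel J \<partial>lborel \<partial>lborel \<partial>lborel)"
    by (simp add: nn_integral_cmult_indicator)
  also have "\<dots> = (\<integral>\<^sup>+p. F p * emeasure lborel J \<partial>lborel)"
    by (simp add: nn_integral_lborel_prod)
  finally show ?thesis by (simp add: nn_integral_multc mult.commute)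
qed

section \<open>The Poisson process of marked lines\<close>

text \<open>Names the majorant hidden in the existential of \<open>class_F\<close>. Its moments give
  integrability of the kernels, while \<open>sigma_pos\<close> excludes a degenerate intensity in
  \<open>not_AE_zero\<close>.\<close>

locale line_intensity =
  fixes f :: "real \<times> real \<times> real \<Rightarrow> real" and \<gamma> :: "real \<times> real \<Rightarrow> real"
  assumes f_measurable [measurable]: "f \<in> borel_measurable borel"
    and f_nonneg: "0 \<le> f p"
    and \<gamma>_measurable [measurable]: "\<gamma> \<in> borel_measurable borel"
    and f_le: "f (x, y) \<le> \<gamma> y"
    and \<gamma>_moment: "(\<integral>\<^sup>+ y. ennreal ((fst y ^ 2 + snd y ^ 2 + 1) * \<gamma> y) \<partial>lborel) < \<infinity>"
    and sigma_pos: "0 < sigma_f f x"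
begin

abbreviation intensity :: "(real \<times> real \<times> real \<times> real) measure" where
  "intensity \<equiv> density lborel (\<lambda>q. ennreal (f (proj3 q)))"

lemma \<gamma>_nonneg: "0 \<le> \<gamma> y"
  using f_nonneg[of "(0, y)"] f_le[of 0 y] by linarith

lemma \<gamma>_finite: "(\<integral>\<^sup>+ y. ennreal (\<gamma> y) \<partial>lborel) < \<infinity>"
proof (rule order.strict_trans1[OF nn_integral_mono \<gamma>_moment])
  show "ennreal (\<gamma> y) \<le> ennreal ((fst y ^ 2 + snd y ^ 2 + 1) * \<gamma> y)" for y
    using \<gamma>_nonneg[of y] by (intro ennreal_leI) (simp add: distrib_right)
qed

definition \<gamma>_mass :: real where
  "\<gamma>_mass = enn2real (\<integral>\<^sup>+ y. ennreal (\<gamma> y) \<partial>lborel)"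

lemma nn_integral_\<gamma>: "(\<integral>\<^sup>+ y. ennreal (\<gamma> y) \<partial>lborel) = ennreal \<gamma>_mass"
  using \<gamma>_finite by (simp add: \<gamma>_mass_def ennreal_enn2real_if)

lemma \<gamma>_mass_nonneg [simp]: "0 \<le> \<gamma>_mass"
  by (simp add: \<gamma>_mass_def)

text \<open>\<open>f\<close> is dominated uniformly in position, so the mass is at most linear in
  the width of the slab. This yields local finiteness and the rate needed to exclude coincident
  projections.\<close>

lemma emeasure_slab_le:
  assumes [measurable]: "I \<in> sets borel" "J \<in> sets borel"
  shows "emeasure intensity {q. fst q \<in> I \<and> zcoord q \<in> J} \<le>
    emeasure lborel J * (emeasure lborel I * ennreal \<gamma>_mass)"
proof -
  have F: "(\<lambda>p. ennreal (f p) * indicator I (fst p)) \<in> borel_measurable borel"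
  proof -
    have [measurable]: "(fst :: real \<times> real \<times> real \<Rightarrow> real) \<in> borel_measurable borel"
      by (intro borel_measurable_continuous_onI continuous_intros)
    show ?thesis by measurable
  qed
  have [measurable]: "(fst :: real \<times> real \<times> real \<times> real \<Rightarrow> real) \<in> borel_measurable borel"
    by (intro borel_measurable_continuous_onI continuous_intros)
  have "{q :: real \<times> real \<times> real \<times> real. fst q \<in> I \<and> zcoord q \<in> J} = {q \<in> space borel. fst q \<in> I \<and> zcoord q \<in> J}" by simp
  also have "\<dots> \<in> sets borel" by measurable
  finally have S: "{q. fst q \<in> I \<and> zcoord q \<in> J} \<in> sets lborel" by simp
  have "emeasure intensity {q. fst q \<in> I \<and> zcoord q \<in> J} =
      (\<integral>\<^sup>+q. ennreal (f (proj3 q)) * indicator {q. fst q \<in> I \<and> zcoord q \<in> J} q \<partial>lborel)"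
    using S by (simp add: emeasure_density)
  also have "\<dots> = (\<integral>\<^sup>+q. (\<lambda>p. ennreal (f p) * indicator I (fst p)) (proj3 q) * indicator J (zcoord q) \<partial>lborel)"
    by (intro nn_integral_cong) (simp add: proj3_def split: split_indicator)
  also have "\<dots> = emeasure lborel J * (\<integral>\<^sup>+p. ennreal (f p) * indicator I (fst p) \<partial>lborel)"
    by (rule nn_integral_proj3_zcoord[OF F]) simp
  also have "(\<integral>\<^sup>+p. ennreal (f p) * indicator I (fst p) \<partial>lborel) =
      (\<integral>\<^sup>+x. \<integral>\<^sup>+y. ennreal (f (x, y)) * indicator I x \<partial>lborel \<partial>lborel)"
    by (subst nn_integral_lborel_prod[OF F]) simp
  also have "\<dots> \<le> (\<integral>\<^sup>+x. \<integral>\<^sup>+y. ennreal (\<gamma> y) * indicator I x \<partial>lborel \<partial>lborel)"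
    by (intro nn_integral_mono mult_right_mono ennreal_leI f_le) simp
  also have "\<dots> = emeasure lborel I * ennreal \<gamma>_mass"
    by (simp add: nn_integral_multc nn_integral_\<gamma> nn_integral_cmult_indicator mult.commute)
  finally show ?thesis by (simp add: mult_left_mono)
qed

lemma intensity_finite:
  assumes "A \<in> sets borel" "bounded A"
  shows "emeasure intensity A < \<infinity>"
proof -
  obtain b where b: "\<And>q. q \<in> A \<Longrightarrow> norm q \<le> b"
    using \<open>bounded A\<close> by (auto simp: bounded_iff)
  have "A \<subseteq> {q. fst q \<in> {-b..b} \<and> zcoord q \<in> {-b..b}}"
  proof
    fix q assume "q \<in> A"
    obtain x v r z where q: "q = (x, v, r, z)" by (cases q)
    have "\<bar>x\<bar> \<le> norm q" "\<bar>z\<bar> \<le> norm q"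
      unfolding q using norm_fst_le[of x "(v, r, z)"] norm_snd_le[of "(v, r, z)" x]
        norm_snd_le[of "(r, z)" v] norm_snd_le[of z r] by auto
    with b[OF \<open>q \<in> A\<close>] show "q \<in> {q. fst q \<in> {-b..b} \<and> zcoord q \<in> {-b..b}}"
      by (auto simp: q zcoord_def)
  qed
  then have "emeasure intensity A \<le> emeasure intensity {q. fst q \<in> {-b..b} \<and> zcoord q \<in> {-b..b}}"
  proof (rule emeasure_mono)
    have "{q :: real \<times> real \<times> real \<times> real. fst q \<in> {-b..b} \<and> zcoord q \<in> {-b..b}} =
        {q. -b \<le> fst q \<and> fst q \<le> b \<and> -b \<le> zcoord q \<and> zcoord q \<le> b}" by auto
    also have "closed \<dots>"
      unfolding zcoord_def by (intro closed_Collect_conj closed_Collect_le continuous_intros)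
    finally show "{q. fst q \<in> {-b..b} \<and> zcoord q \<in> {-b..b}} \<in> sets intensity" by simp
  qed
  also have "\<dots> \<le> emeasure lborel {-b..b} * (emeasure lborel {-b..b} * ennreal \<gamma>_mass)"
    by (rule emeasure_slab_le) auto
  also have "\<dots> < \<infinity>"
    by (simp add: ennreal_mult_less_top emeasure_lborel_Icc_eq)
  finally show ?thesis .
qed

end

section \<open>Almost sure distinctness of the projected points\<close>

text \<open>Multiply exp(-l) >= 1 - l by 1 + l. The quadratic order is what beats the linear growth
  of the number of slabs.\<close>

lemma poisson_ge2_le: "1 - exp (- l) - l * exp (- l) \<le> l\<^sup>2" if "0 \<le> l" for l :: real
proof -
  have "(1 + l) * (1 - l) \<le> (1 + l) * exp (- l)"
    using that exp_ge_add_one_self[of "- l"] by (intro mult_left_mono) auto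
  then show ?thesis by (simp add: algebra_simps power2_eq_square)
qed

lemma (in poisson_process) prob_card_ge2_le:
  assumes A: "A \<in> sets borel" "bounded A"
  shows "prob {\<omega> \<in> space M. 2 \<le> card (X \<omega> \<inter> A)} \<le> (measure \<Lambda> A)\<^sup>2"
proof -
  note [measurable] = card_measurable_nat[OF A]
  have "{\<omega> \<in> space M. 2 \<le> card (X \<omega> \<inter> A)} =
    space M - ({\<omega> \<in> space M. card (X \<omega> \<inter> A) = 0} \<union> {\<omega> \<in> space M. card (X \<omega> \<inter> A) = 1})" by auto
  also have "prob \<dots> = 1 - prob ({\<omega> \<in> space M. card (X \<omega> \<inter> A) = 0} \<union> {\<omega> \<in> space M. card (X \<omega> \<inter> A) = 1})"
    by (intro prob_compl) measurable
  also have "\<dots> = 1 - (prob {\<omega> \<in> space M. card (X \<omega> \<inter> A) = 0} + prob {\<omega> \<in> space M. card (X \<omega> \<inter> A) = 1})"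
    by (subst finite_measure_Union) auto
  also have "\<dots> \<le> (measure \<Lambda> A)\<^sup>2"
    unfolding card_distr[OF A] using poisson_ge2_le[of "measure \<Lambda> A"] by simp
  finally show ?thesis .
qed

locale line_poisson = line_intensity f \<gamma> for f \<gamma> +
  fixes M :: "'a measure" and X :: "'a \<Rightarrow> (real \<times> real \<times> real \<times> real) set"
  assumes ppp_lines: "poisson_point_process M intensity X"
begin

sublocale poisson_process M intensity X
  by standard (fact ppp_lines, fact intensity_finite)

definition layer :: "real \<Rightarrow> (real \<times> real \<times> real \<times> real) set" where
  "layer c = {q. 0 < zcoord q \<and> zcoord q < c}"

lemma layer_measurable [measurable]: "layer c \<in> sets borel"
proof -
  have "layer c = {q \<in> space borel. 0 < zcoord q \<and> zcoord q < c}" by (simp add: layer_def)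
  also have "\<dots> \<in> sets borel" by measurable
  finally show ?thesis .
qed

text \<open>Cutting a box into slabs of width \<open>1 / m\<close> in the first coordinate, two points in the
  same slab occur with probability of order \<open>1 / m\<close>; hence the first coordinates are almost
  surely distinct.\<close>
lemma AE_inj_on_proj3:
  assumes "0 < c"
  shows "AE \<omega> in M. inj_on proj3 (X \<omega> \<inter> layer c)"
proof -
  \<comment> \<open>The first coordinate is kept in a half-open interval so that its slab index
    falls in the half-open integer range of \<open>E\<close>.\<close>
  define B where "B n = {q. fst q \<in> {- real n..<real n} \<and> q \<in> cball 0 (real n) \<and> q \<in> layer c}" for n
  define A where "A n m j = {q \<in> B n. fst q \<in> {real_of_int j / real m..<(real_of_int j + 1) / real m}}"
    for n m :: nat and j
  define xc where "xc = (fst :: real \<times> real \<times> real \<times> real \<Rightarrow> real)"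
  have [measurable]: "xc \<in> borel_measurable borel"
    unfolding xc_def by (intro borel_measurable_continuous_onI continuous_intros)
  have A: "A n m j \<in> sets borel" "bounded (A n m j)" for n m j
  proof -
    have [measurable]: "cball (0 :: real \<times> real \<times> real \<times> real) (real n) \<in> sets borel" by simp
    have "A n m j = {q \<in> space borel. xc q \<in> {- real n..<real n} \<and> q \<in> cball 0 (real n) \<and> q \<in> layer c \<and>
        xc q \<in> {real_of_int j / real m..<(real_of_int j + 1) / real m}}"
      by (auto simp: A_def B_def xc_def)
    also have "\<dots> \<in> sets borel" by measurable
    finally show "A n m j \<in> sets borel" .
    show "bounded (A n m j)"
      by (rule bounded_subset[OF bounded_cball[of 0 "real n"]]) (auto simp: A_def B_def)
  qed
  define C where "C = c * \<gamma>_mass"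
  have "0 \<le> C" using \<open>0 < c\<close> by (simp add: C_def)
  have A_le: "measure intensity (A n m j) \<le> C / real m" if "0 < m" for n m j
  proof -
    let ?I = "{real_of_int j / real m..<(real_of_int j + 1) / real m}"
    have S: "{q. fst q \<in> ?I \<and> zcoord q \<in> {0<..<c}} \<in> sets intensity"
    proof -
      have "{q :: real \<times> real \<times> real \<times> real. fst q \<in> ?I \<and> zcoord q \<in> {0<..<c}} =
         {q \<in> space borel. xc q \<in> ?I \<and> zcoord q \<in> {0<..<c}}" by (simp add: xc_def)
      also have "\<dots> \<in> sets borel" by measurable
      finally show ?thesis by simp
    qed
    have "emeasure intensity (A n m j) \<le> emeasure intensity {q. fst q \<in> ?I \<and> zcoord q \<in> {0<..<c}}"
      by (rule emeasure_mono[OF _ S]) (auto simp: A_def B_def layer_def)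
    also have "\<dots> \<le> emeasure lborel {0<..<c} * (emeasure lborel ?I * ennreal \<gamma>_mass)"
      by (rule emeasure_slab_le) auto
    also have "\<dots> = ennreal (C / real m)"
      using that \<open>0 < c\<close>
      by (simp add: C_def ennreal_mult[symmetric] divide_right_mono diff_divide_distrib[symmetric])
    finally show ?thesis
      using \<open>0 \<le> C\<close> by (simp add: measure_def enn2real_leI)
  qed
  define E where "E n m = (\<Union>j\<in>{- int (n * m)..<int (n * m)}. {\<omega> \<in> space M. 2 \<le> card (X \<omega> \<inter> A n m j)})"
    for n m
  have E_sets [measurable]: "E n m \<in> sets M" for n m
  proof -
    have "{\<omega> \<in> space M. 2 \<le> card (X \<omega> \<inter> A n m j)} \<in> sets M" for j
    proof -
      note [measurable] = card_measurable_nat[OF A(1)[of n m j] A(2)[of n m j]]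
      show ?thesis by measurable
    qed
    then show ?thesis by (auto simp: E_def)
  qed
  have E_le: "prob (E n m) \<le> 2 * real n * C\<^sup>2 / real m" if "0 < m" for n m
  proof -
    have "prob (E n m) \<le> (\<Sum>j\<in>{- int (n * m)..<int (n * m)}. prob {\<omega> \<in> space M. 2 \<le> card (X \<omega> \<inter> A n m j)})"
      unfolding E_def
    proof (rule finite_measure_subadditive_finite)
      have "{\<omega> \<in> space M. 2 \<le> card (X \<omega> \<inter> A n m j)} \<in> sets M" for j
      proof -
        note [measurable] = card_measurable_nat[OF A(1)[of n m j] A(2)[of n m j]]
        show ?thesis by measurable
      qed
      then show "(\<lambda>j. {\<omega> \<in> space M. 2 \<le> card (X \<omega> \<inter> A n m j)}) ` {- int (n * m)..<int (n * m)} \<subseteq> sets M"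
        by auto
    qed simp
    also have "\<dots> \<le> (\<Sum>j\<in>{- int (n * m)..<int (n * m)}. (C / real m)\<^sup>2)"
      by (intro sum_mono order_trans[OF prob_card_ge2_le[OF A]] power_mono A_le that) simp
    \<comment> \<open>There are 2 n m slabs, each contributing (C/m)^2.\<close>
    also have "\<dots> = 2 * real n * C\<^sup>2 / real m"
      using that by (simp add: power2_eq_square nat_add_distrib nat_mult_distrib field_simps)
    finally show ?thesis .
  qed
  have "AE \<omega> in M. inj_on proj3 (X \<omega> \<inter> B n)" for n
  proof -
    \<comment> \<open>\<open>Suc\<close> avoids m = 0, for which \<open>E_le\<close> gives no
      bound.\<close>
    define N where "N = (\<Inter>m. E n (Suc m))"
    have N_sets: "N \<in> sets M" unfolding N_def by (intro sets.countable_INT') (auto simp: E_sets)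
    have N_le: "prob N \<le> 2 * real n * C\<^sup>2 / real (Suc m)" for m
    proof -
      have "prob N \<le> prob (E n (Suc m))"
        by (intro finite_measure_mono E_sets) (auto simp: N_def)
      also have "\<dots> \<le> 2 * real n * C\<^sup>2 / real (Suc m)" by (rule E_le) simp
      finally show ?thesis .
    qed
    have "prob N \<le> 0"
    proof (rule LIMSEQ_le_const)
      show "(\<lambda>m. 2 * real n * C\<^sup>2 / real (Suc m)) \<longlonglongrightarrow> 0"
        using LIMSEQ_Suc[OF lim_const_over_n[of "2 * real n * C\<^sup>2"]] by simp
    qed (use N_le in auto)
    then have "N \<in> null_sets M"
      using N_sets by (simp add: null_sets_def emeasure_eq_measure measure_le_0_iff)
    then show ?thesis
    proof (rule AE_I', intro subsetI)
      fix \<omega> assume "\<omega> \<in> {\<omega> \<in> space M. \<not> inj_on proj3 (X \<omega> \<inter> B n)}"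
      then obtain p q where \<omega>: "\<omega> \<in> space M" and pq: "p \<in> X \<omega> \<inter> B n" "q \<in> X \<omega> \<inter> B n" "p \<noteq> q" "proj3 p = proj3 q"
        unfolding inj_on_def by blast
      show "\<omega> \<in> N"
        unfolding N_def
      proof
        fix k :: nat
        define m where "m = Suc k"
        have m: "0 < m" by (simp add: m_def)
        \<comment> \<open>Equal projections have equal first coordinates, so both points share a
          slab at every resolution.\<close>
        define j where "j = \<lfloor>fst p * real m\<rfloor>"
        have x: "fst q = fst p" using pq(4) by (simp add: proj3_def)
        have j: "real_of_int j \<le> fst p * real m" "fst p * real m < real_of_int j + 1"
          unfolding j_def by linarith+
        have "p \<in> A n m j" "q \<in> A n m j"
          using pq(1,2) m j by (auto simp: A_def x divide_le_eq less_divide_eq)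
        then have sub: "{p, q} \<subseteq> X \<omega> \<inter> A n m j" using pq by auto
        have "2 = card {p, q}" using pq(3) by simp
        also have "\<dots> \<le> card (X \<omega> \<inter> A n m j)"
          using finite_bounded[OF \<omega> A(2)] sub by (rule card_mono)
        finally have "2 \<le> card (X \<omega> \<inter> A n m j)" .
        moreover have "j \<in> {- int (n * m)..<int (n * m)}"
        proof -
          have "- real n \<le> fst p" "fst p < real n" using pq(1) by (auto simp: B_def)
          then have "- real n * real m \<le> fst p * real m" "fst p * real m < real n * real m"
            using m by (intro mult_right_mono mult_strict_right_mono; simp)+
          then show ?thesis unfolding j_def by (auto simp: le_floor_iff floor_less_iff)
        qed
        ultimately show "\<omega> \<in> E n (Suc k)" using \<omega> by (auto simp: E_def m_def)
      qed
    qed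
  qed
  then have "AE \<omega> in M. \<forall>n. inj_on proj3 (X \<omega> \<inter> B n)" by (simp add: AE_all_countable)
  then show ?thesis
  proof eventually_elim
    case (elim \<omega>)
    show ?case
    proof (rule inj_onI)
      fix p q assume pq: "p \<in> X \<omega> \<inter> layer c" "q \<in> X \<omega> \<inter> layer c" "proj3 p = proj3 q"
      \<comment> \<open>The extra 1 makes the upper bound on the first coordinates strict, as
        \<open>B\<close> demands.\<close>
      obtain n :: nat where n: "norm p + norm q + 1 \<le> real n" using real_arch_simple by blast
      have "\<bar>fst s\<bar> \<le> norm s" for s :: "real \<times> real \<times> real \<times> real"
        using norm_fst_le[of "fst s" "snd s"] by simp
      from this[of p] this[of q] have "p \<in> B n" "q \<in> B n"
        using pq n norm_ge_zero[of p] norm_ge_zero[of q] by (auto simp: B_def abs_le_iff simp del: norm_ge_zero)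
      with pq elim[rule_format, of n] show "p = q" by (auto dest: inj_onD)
    qed
  qed
qed

end

section \<open>Sums over the thinned and projected process\<close>

context line_poisson
begin

lemma X_eps_eq: "X_eps \<epsilon> X \<omega> = proj3 ` (X \<omega> \<inter> layer (1 / \<epsilon>))"
  by (force simp: X_eps_def proj3_def layer_def zcoord_def)

text \<open>The layer confines exactly the coordinate that \<open>proj3\<close> forgets; hence local
  finiteness survives the projection.\<close>

lemma bounded_layer_proj3:
  assumes "bounded A"
  shows "bounded (layer c \<inter> proj3 -` A)"
proof -
  obtain b where b: "\<And>p. p \<in> A \<Longrightarrow> norm p \<le> b"
    using assms by (auto simp: bounded_iff)
  have "norm q \<le> b + b + b + \<bar>c\<bar>" if "q \<in> layer c \<inter> proj3 -` A" for q
  proof -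
    obtain x v r z where q: "q = (x, v, r, z)" by (cases q)
    have "norm (x, v, r) \<le> b" using that b by (auto simp: q proj3_def)
    moreover have "norm x \<le> norm (x, v, r)" "norm v \<le> norm (x, v, r)" "norm r \<le> norm (x, v, r)"
      using norm_fst_le[of x "(v, r)"] norm_snd_le[of "(v, r)" x] norm_fst_le[of v r] norm_snd_le[of r v]
      by auto
    moreover have "norm z \<le> \<bar>c\<bar>" using that by (auto simp: q layer_def zcoord_def)
    moreover have "norm q \<le> norm x + (norm v + (norm r + norm z))"
      unfolding q using norm_Pair_le[of x "(v, r, z)"] norm_Pair_le[of v "(r, z)"] norm_Pair_le[of r z]
      by linarith
    ultimately show ?thesis by linarith
  qed
  then show ?thesis unfolding bounded_iff by blast
qed

lemma point_config_X_eps: "point_config M (X_eps \<epsilon> X)"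
  using point_config_image[OF proj3_measurable layer_measurable bounded_layer_proj3, of "1 / \<epsilon>"]
  by (simp add: X_eps_eq[abs_def])

lemma distr_layer_proj3:
  assumes "0 < c"
  shows "distr (density lborel (\<lambda>q. ennreal (indicator (layer c) q))) borel proj3 =
    density lborel (\<lambda>_. ennreal c)"
proof (rule measure_eqI)
  fix A :: "(real \<times> real \<times> real) set"
  assume "A \<in> sets (distr (density lborel (\<lambda>q. ennreal (indicator (layer c) q))) borel proj3)"
  then have A [measurable]: "A \<in> sets borel" by simp
  have V: "proj3 -` A \<in> sets borel" using measurable_sets[OF proj3_measurable A] by simp
  have "emeasure (distr (density lborel (\<lambda>q. ennreal (indicator (layer c) q))) borel proj3) A =
     (\<integral>\<^sup>+q. ennreal (indicator (layer c) q) * indicator (proj3 -` A) q \<partial>lborel)"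
    using V by (simp add: emeasure_distr emeasure_density)
  also have "\<dots> = (\<integral>\<^sup>+q. indicator A (proj3 q) * indicator {0<..<c} (zcoord q) \<partial>lborel)"
    by (intro nn_integral_cong) (auto simp: layer_def split: split_indicator)
  also have "\<dots> = ennreal c * (\<integral>\<^sup>+p. indicator A p \<partial>lborel)"
    using \<open>0 < c\<close> by (subst nn_integral_proj3_zcoord) auto
  also have "\<dots> = emeasure (density lborel (\<lambda>_. ennreal c)) A"
    by (simp add: emeasure_density nn_integral_cmult_indicator)
  finally show "emeasure (distr (density lborel (\<lambda>q. ennreal (indicator (layer c) q))) borel proj3) A =
    emeasure (density lborel (\<lambda>_. ennreal c)) A" .
qed simp

lemma
  fixes h :: "real \<times> real \<times> real \<Rightarrow> 'c::{banach, second_countable_topology}"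
  assumes "0 < c" and [measurable]: "h \<in> borel_measurable borel"
  shows integral_layer_proj3:
      "(\<integral>q. indicator (layer c) q *\<^sub>R h (proj3 q) \<partial>lborel) = c *\<^sub>R (\<integral>p. h p \<partial>lborel)"
    and integrable_layer_proj3:
      "integrable lborel h \<Longrightarrow> integrable lborel (\<lambda>q. indicator (layer c) q *\<^sub>R h (proj3 q))"
proof -
  let ?D = "density lborel (\<lambda>q. ennreal (indicator (layer c) q))"
  have [measurable]: "proj3 \<in> measurable ?D borel" by simp
  have "(\<integral>q. indicator (layer c) q *\<^sub>R h (proj3 q) \<partial>lborel) = (\<integral>q. h (proj3 q) \<partial>?D)"
    by (subst integral_density) auto
  also have "\<dots> = (\<integral>p. h p \<partial>distr ?D borel proj3)"
    by (subst integral_distr) auto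
  also have "\<dots> = c *\<^sub>R (\<integral>p. h p \<partial>lborel)"
    unfolding distr_layer_proj3[OF \<open>0 < c\<close>] using \<open>0 < c\<close> by (subst integral_density) auto
  finally show "(\<integral>q. indicator (layer c) q *\<^sub>R h (proj3 q) \<partial>lborel) = c *\<^sub>R (\<integral>p. h p \<partial>lborel)" .
  assume "integrable lborel h"
  then have "integrable (distr ?D borel proj3) h"
    unfolding distr_layer_proj3[OF \<open>0 < c\<close>] using \<open>0 < c\<close> by (subst integrable_density) auto
  then have "integrable ?D (\<lambda>q. h (proj3 q))"
    by (subst (asm) integrable_distr_eq) auto
  then show "integrable lborel (\<lambda>q. indicator (layer c) q *\<^sub>R h (proj3 q))"
    by (subst (asm) integrable_density) auto
qed

lemma integrable_intensity_layer:
  fixes g :: "real \<times> real \<times> real \<Rightarrow> real"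
  assumes "0 < c" and [measurable]: "g \<in> borel_measurable borel"
    and "integrable lborel (\<lambda>p. f p * g p)"
  shows "integrable intensity (\<lambda>q. indicator (layer c) q * g (proj3 q))"
proof -
  have "integrable lborel (\<lambda>q. indicator (layer c) q *\<^sub>R (f (proj3 q) * g (proj3 q)))"
    using assms by (intro integrable_layer_proj3[of c "\<lambda>p. f p * g p"]) auto
  then have "integrable lborel (\<lambda>q. f (proj3 q) *\<^sub>R (indicator (layer c) q * g (proj3 q)))"
    by (simp add: mult_ac)
  then show ?thesis
    by (subst integrable_density) (auto simp: f_nonneg)
qed

text \<open>Almost surely \<open>proj3\<close> is injective on the points in the layer, so summing
  over the image set loses no multiplicity. Campbell's formula gives the summability.\<close>

lemma AE_infsum_X_eps:
  fixes g :: "real \<times> real \<times> real \<Rightarrow> real"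
  assumes "0 < \<epsilon>" and "g \<in> borel_measurable borel" and "integrable lborel (\<lambda>p. f p * g p)"
  shows "AE \<omega> in M. g summable_on X_eps \<epsilon> X \<omega> \<and>
    infsum g (X_eps \<epsilon> X \<omega>) = infsum (\<lambda>q. indicator (layer (1 / \<epsilon>)) q * g (proj3 q)) (X \<omega>)"
proof -
  have c: "0 < 1 / \<epsilon>" using assms by simp
  show ?thesis
    using AE_inj_on_proj3[OF c] AE_integrable_count_space[OF integrable_intensity_layer[OF c assms(2,3)]]
  proof eventually_elim
    case (elim \<omega>)
    let ?L = "layer (1 / \<epsilon>)"
    let ?G = "\<lambda>q. indicator ?L q * g (proj3 q)"
    have "?G summable_on X \<omega>"
      using elim(2) by (simp add: summable_on_iff_integrable_count_space)
    then have "(\<lambda>q. g (proj3 q)) summable_on (X \<omega> \<inter> ?L)"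
      by (rule summable_on_cong_neutral[THEN iffD1, rotated -1]) (auto simp: indicator_def)
    then have "g summable_on proj3 ` (X \<omega> \<inter> ?L)"
      by (subst summable_on_reindex[OF elim(1)]) (simp add: o_def)
    moreover have "infsum g (proj3 ` (X \<omega> \<inter> ?L)) = infsum (\<lambda>q. g (proj3 q)) (X \<omega> \<inter> ?L)"
      using infsum_reindex[OF elim(1)] by (simp add: o_def)
    moreover have "\<dots> = infsum ?G (X \<omega>)"
      by (rule infsum_cong_neutral) (auto simp: indicator_def)
    ultimately show ?case by (simp add: X_eps_eq)
  qed
qed

text \<open>Obtained from the process on four coordinates, applied to \<open>g\<close> composed with
  \<open>proj3\<close> and cut to the layer; the thinned process need not be shown to be
  Poisson.\<close>

lemma char_functional_X_eps:
  fixes g :: "real \<times> real \<times> real \<Rightarrow> real"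
  assumes "0 < \<epsilon>" and [measurable]: "g \<in> borel_measurable borel"
    and int: "integrable lborel (\<lambda>p. f p * g p)"
  shows "(CLINT \<omega>|M. iexp (infsum g (X_eps \<epsilon> X \<omega>))) =
    exp ((1 / \<epsilon>) *\<^sub>R (CLINT p|lborel. f p *\<^sub>R (iexp (g p) - 1)))"
proof -
  \<comment> \<open>\<open>integral_cong_AE\<close> needs both integrands measurable, and this
    provides it for the sum over the image set.\<close>
  interpret P: point_config M "X_eps \<epsilon> X" by (rule point_config_X_eps)
  have c: "0 < 1 / \<epsilon>" using assms by simp
  let ?G = "\<lambda>q. indicator (layer (1 / \<epsilon>)) q * g (proj3 q)"
  have "(CLINT \<omega>|M. iexp (infsum g (X_eps \<epsilon> X \<omega>))) = (CLINT \<omega>|M. iexp (infsum ?G (X \<omega>)))"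
    using AE_infsum_X_eps[OF assms] by (intro integral_cong_AE) auto
  also have "\<dots> = exp (CLINT q|intensity. iexp (?G q) - 1)"
    by (rule char_functional[OF integrable_intensity_layer[OF c _ int]]) simp
  also have "(CLINT q|intensity. iexp (?G q) - 1) = (CLINT q|lborel. f (proj3 q) *\<^sub>R (iexp (?G q) - 1))"
    by (subst integral_density) (auto simp: f_nonneg)
  also have "\<dots> = (CLINT q|lborel. indicator (layer (1 / \<epsilon>)) q *\<^sub>R (f (proj3 q) *\<^sub>R (iexp (g (proj3 q)) - 1)))"
    by (intro Bochner_Integration.integral_cong) (auto simp: indicator_def)
  also have "\<dots> = (1 / \<epsilon>) *\<^sub>R (CLINT p|lborel. f p *\<^sub>R (iexp (g p) - 1))"
    by (rule integral_layer_proj3[OF c]) measurable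
  finally show ?thesis .
qed

end

section \<open>Lines and segments\<close>

text \<open>Height of the line above the space-time point \<open>a\<close>, taken at the time of
  \<open>a\<close>.\<close>

definition offset :: "real \<times> real \<Rightarrow> real \<times> real \<times> real \<Rightarrow> real" where
  "offset a p = fst p + fst (snd p) * fst a - snd a"

definition side :: "real \<times> real \<Rightarrow> real \<times> real \<times> real \<Rightarrow> real" where
  "side a p = (if offset a p < 0 then 1 else 0)"

abbreviation kern :: "real \<times> real \<Rightarrow> real \<times> real \<times> real \<Rightarrow> real" where
  "kern a \<equiv> kernel_H (fst a) (snd a)"

text \<open>At the origin \<open>offset\<close> is the initial position, so the two indicators in
  \<open>kernel_H\<close> are the two ways in which the sides of \<open>a\<close> and of the origin
  can differ.\<close>

lemma kern_eq: "kern a p = snd (snd p) * (side a p - side (0, 0) p)"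
  by (cases p) (auto simp: kernel_H_def side_def offset_def)

lemma offset_measurable [measurable]: "offset a \<in> borel_measurable borel"
  unfolding offset_def by (intro borel_measurable_continuous_onI continuous_intros)

lemma side_measurable [measurable]: "side a \<in> borel_measurable borel"
  unfolding side_def by measurable

lemma mark_measurable [measurable]:
  "(\<lambda>p :: real \<times> real \<times> real. snd (snd p)) \<in> borel_measurable borel"
  by (intro borel_measurable_continuous_onI continuous_intros)

lemma kern_measurable [measurable]: "kern a \<in> borel_measurable borel"
  unfolding kern_eq[abs_def] by measurable

lemma kern_origin: "kern (0, 0) p = 0"
  by (simp only: kern_eq) simp

lemma kern_diff: "kern a p - kern b p = snd (snd p) * (side a p - side b p)"
  unfolding kern_eq by (simp add: algebra_simps)

text \<open>The offset is affine along the segment and vanishes exactly at points of the line, so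
  the line is hit iff the end values do not have the same strict sign.\<close>

lemma line_hits_segment_iff:
  "range (\<lambda>s. (s, x + v * s)) \<inter> closed_segment a b \<noteq> {} \<longleftrightarrow>
    offset a (x, v, r) * offset b (x, v, r) \<le> 0"
proof
  let ?A = "offset a (x, v, r)" and ?B = "offset b (x, v, r)"
  have conv: "x + v * fst ((1 - u) *\<^sub>R a + u *\<^sub>R b) - snd ((1 - u) *\<^sub>R a + u *\<^sub>R b) =
      (1 - u) * ?A + u * ?B" for u
    by (simp add: offset_def algebra_simps)
  {
    assume "range (\<lambda>s. (s, x + v * s)) \<inter> closed_segment a b \<noteq> {}"
    then obtain s u where u: "0 \<le> u" "u \<le> 1" and "(s, x + v * s) = (1 - u) *\<^sub>R a + u *\<^sub>R b"
      by (auto simp: closed_segment_def)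
    then have zero: "(1 - u) * ?A + u * ?B = 0" unfolding conv[symmetric] by (metis diff_self fst_conv snd_conv)
    show "?A * ?B \<le> 0"
    proof (rule ccontr)
      assume "\<not> ?A * ?B \<le> 0"
      then consider "?A > 0" "?B > 0" | "?A < 0" "?B < 0" by (auto simp: not_le zero_less_mult_iff)
      then show False
      proof cases
        case 1
        then have "0 \<le> (1 - u) * ?A" "0 \<le> u * ?B"
          using u by (auto intro: mult_nonneg_nonneg)
        with zero have "(1 - u) * ?A = 0" "u * ?B = 0" by linarith+
        with 1 show False by auto
      next
        case 2
        then have "(1 - u) * ?A \<le> 0" "u * ?B \<le> 0"
          using u by (auto intro: mult_nonneg_nonpos)
        with zero have "(1 - u) * ?A = 0" "u * ?B = 0" by linarith+
        with 2 show False by auto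
      qed
    qed
  }
  {
    assume le: "?A * ?B \<le> 0"
    obtain u where u: "0 \<le> u" "u \<le> 1" "(1 - u) * ?A + u * ?B = 0"
    proof (cases "?A = ?B")
      case True
      then have "?A = 0" using le by (auto simp: mult_le_0_iff)
      then show ?thesis using that[of 0] by simp
    next
      case False
      have "(?A \<le> 0 \<and> 0 \<le> ?B) \<or> (0 \<le> ?A \<and> ?B \<le> 0)" using le by (auto simp: mult_le_0_iff)
      \<comment> \<open>This quotient is the zero of the affine function with value
        \<open>?A\<close> at 0 and \<open>?B\<close> at 1.\<close>
      then have "0 \<le> ?A / (?A - ?B)" "?A / (?A - ?B) \<le> 1"
        using False by (auto simp: zero_le_divide_iff divide_le_eq)
      moreover have "(1 - ?A / (?A - ?B)) * ?A + ?A / (?A - ?B) * ?B = 0"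
        using False by (simp add: field_simps)
      ultimately show ?thesis by (rule that)
    qed
    let ?c = "(1 - u) *\<^sub>R a + u *\<^sub>R b"
    have "?c = (fst ?c, x + v * fst ?c)"
      using conv[of u] u(3) by (intro prod_eqI) auto
    then have "?c \<in> range (\<lambda>s. (s, x + v * s))" by blast
    moreover have "?c \<in> closed_segment a b" using u by (auto simp: closed_segment_def)
    ultimately show "range (\<lambda>s. (s, x + v * s)) \<inter> closed_segment a b \<noteq> {}" by blast
  }
qed

text \<open>Lines through a fixed point form a hyperplane of parameters. Discarding them reconciles
  the closed condition in \<open>line_hits_segment_iff\<close> with the half-open convention of
  \<open>side\<close>.\<close>

lemma AE_offset_nonzero: "AE p in lborel. offset a p \<noteq> 0"
proof -
  have eq: "{p. offset a p = 0} = {p. (1, fst a, 0) \<bullet> p = snd a}"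
    by (auto simp: offset_def inner_prod_def mult.commute)
  have "negligible {p :: real \<times> real \<times> real. (1, fst a, 0) \<bullet> p = snd a}"
    by (rule negligible_hyperplane) (simp add: zero_prod_def)
  then have "{p. offset a p = 0} \<in> null_sets lebesgue"
    unfolding eq negligible_iff_null_sets .
  moreover have "{p. offset a p = 0} \<in> sets lborel"
    using measurable_sets[OF offset_measurable, of "{0}" a] by (simp add: vimage_def)
  ultimately have "{p. offset a p = 0} \<in> null_sets lborel"
    by (simp add: null_sets_completion_iff)
  then show ?thesis
    by (rule AE_I') auto
qed

text \<open>The squared difference of two sides is the indicator that they differ. The integrands
  agree almost everywhere, so the identity also holds when both integrals diverge and default to
  0.\<close>

lemma line_dist_eq:
  assumes [measurable]: "f \<in> borel_measurable borel"
  shows "line_dist f a b = (\<integral>p. f p * (kern a p - kern b p)\<^sup>2 \<partial>lborel)"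
proof -
  have "line_dist f a b =
    (\<integral>p. f p * (snd (snd p))\<^sup>2 * indicator {p. offset a p * offset b p \<le> 0} p \<partial>lborel)"
  proof -
    have "{(x, v, r). range (\<lambda>s. (s, x + v * s)) \<inter> closed_segment a b \<noteq> {}} =
        {p. offset a p * offset b p \<le> 0}"
    proof (rule set_eqI)
      fix p :: "real \<times> real \<times> real"
      obtain x v r where p: "p = (x, v, r)" by (cases p)
      show "p \<in> {(x, v, r). range (\<lambda>s. (s, x + v * s)) \<inter> closed_segment a b \<noteq> {}} \<longleftrightarrow>
          p \<in> {p. offset a p * offset b p \<le> 0}"
        unfolding p using line_hits_segment_iff[of x v a b r] by (simp only: mem_Collect_eq split_conv)
    qed
    then show ?thesis by (simp only: line_dist_def) (simp add: case_prod_beta)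
  qed
  also have "\<dots> = (\<integral>p. f p * (kern a p - kern b p)\<^sup>2 \<partial>lborel)"
  proof (rule integral_cong_AE)
    have "{p. offset a p * offset b p \<le> 0} = {p \<in> space borel. offset a p * offset b p \<le> 0}" by simp
    also have "\<dots> \<in> sets borel" by measurable
    finally have [measurable]: "{p. offset a p * offset b p \<le> 0} \<in> sets borel" .
    show "(\<lambda>p. f p * (snd (snd p))\<^sup>2 * indicator {p. offset a p * offset b p \<le> 0} p) \<in> borel_measurable lborel"
      by measurable
    show "(\<lambda>p. f p * (kern a p - kern b p)\<^sup>2) \<in> borel_measurable lborel" by measurable
    show "AE p in lborel. f p * (snd (snd p))\<^sup>2 * indicator {p. offset a p * offset b p \<le> 0} p =
        f p * (kern a p - kern b p)\<^sup>2"
      using AE_offset_nonzero[of a] AE_offset_nonzero[of b]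
      by eventually_elim
         (auto simp: kern_diff side_def power_mult_distrib mult_le_0_iff split: split_indicator)
  qed
  finally show ?thesis .
qed

section \<open>Integrability of the kernels\<close>

lemma nn_integral_lborel_prod_swap:
  fixes F :: "'a::euclidean_space \<times> 'b::euclidean_space \<Rightarrow> ennreal"
  assumes [measurable]: "F \<in> borel_measurable borel"
  shows "(\<integral>\<^sup>+p. F p \<partial>lborel) = (\<integral>\<^sup>+y. \<integral>\<^sup>+x. F (x, y) \<partial>lborel \<partial>lborel)"
proof -
  have [measurable]: "F \<in> borel_measurable (lborel \<Otimes>\<^sub>M lborel)" by (simp add: lborel_prod)
  show ?thesis
    by (simp add: lborel_prod[symmetric] lborel_pair.nn_integral_snd)
qed

context line_intensity
begin

text \<open>At fixed velocity the sides differ only for initial positions between the points where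
  lines of that velocity through \<open>a\<close> and \<open>b\<close> cross time 0. The power
  \<open>m\<close> is 1 for kernels and 2 for their squares.\<close>

lemma nn_integral_side_le:
  fixes m :: nat
  shows "(\<integral>\<^sup>+p. ennreal (f p * \<bar>snd (snd p)\<bar> ^ m * \<bar>side a p - side b p\<bar>) \<partial>lborel) \<le>
    (\<integral>\<^sup>+y. ennreal (\<gamma> y * \<bar>snd y\<bar> ^ m * \<bar>(snd a - fst y * fst a) - (snd b - fst y * fst b)\<bar>) \<partial>lborel)"
proof -
  have "(\<integral>\<^sup>+p. ennreal (f p * \<bar>snd (snd p)\<bar> ^ m * \<bar>side a p - side b p\<bar>) \<partial>lborel) =
    (\<integral>\<^sup>+y. \<integral>\<^sup>+x. ennreal (f (x, y) * \<bar>snd y\<bar> ^ m * \<bar>side a (x, y) - side b (x, y)\<bar>) \<partial>lborel \<partial>lborel)"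
    by (subst nn_integral_lborel_prod_swap) auto
  also have "\<dots> \<le> (\<integral>\<^sup>+y. ennreal (\<gamma> y * \<bar>snd y\<bar> ^ m * \<bar>(snd a - fst y * fst a) - (snd b - fst y * fst b)\<bar>) \<partial>lborel)"
  proof (rule nn_integral_mono)
    fix y :: "real \<times> real"
    define A B where "A = snd a - fst y * fst a" and "B = snd b - fst y * fst b"
    have nonneg: "0 \<le> \<gamma> y * \<bar>snd y\<bar> ^ m" using \<gamma>_nonneg by simp
    have "(\<integral>\<^sup>+x. ennreal (f (x, y) * \<bar>snd y\<bar> ^ m * \<bar>side a (x, y) - side b (x, y)\<bar>) \<partial>lborel) \<le>
      (\<integral>\<^sup>+x. ennreal (\<gamma> y * \<bar>snd y\<bar> ^ m) * indicator {min A B..max A B} x \<partial>lborel)"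
    proof (rule nn_integral_mono)
      fix x
      have "\<bar>side a (x, y) - side b (x, y)\<bar> \<le> indicator {min A B..max A B} x"
        by (auto simp: side_def offset_def A_def B_def split: split_indicator)
      then have "f (x, y) * \<bar>snd y\<bar> ^ m * \<bar>side a (x, y) - side b (x, y)\<bar> \<le>
          \<gamma> y * \<bar>snd y\<bar> ^ m * indicator {min A B..max A B} x"
        using nonneg f_nonneg f_le \<gamma>_nonneg by (intro mult_mono) auto
      then show "ennreal (f (x, y) * \<bar>snd y\<bar> ^ m * \<bar>side a (x, y) - side b (x, y)\<bar>) \<le>
          ennreal (\<gamma> y * \<bar>snd y\<bar> ^ m) * indicator {min A B..max A B} x"
        by (auto simp: ennreal_leI ennreal_neg split: split_indicator)
    qed
    also have "\<dots> = ennreal (\<gamma> y * \<bar>snd y\<bar> ^ m) * ennreal \<bar>A - B\<bar>"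
      by (simp add: nn_integral_cmult_indicator min_def max_def)
    also have "\<dots> = ennreal (\<gamma> y * \<bar>snd y\<bar> ^ m * \<bar>A - B\<bar>)"
      using nonneg by (simp add: ennreal_mult)
    finally show "(\<integral>\<^sup>+x. ennreal (f (x, y) * \<bar>snd y\<bar> ^ m * \<bar>side a (x, y) - side b (x, y)\<bar>) \<partial>lborel) \<le>
        ennreal (\<gamma> y * \<bar>snd y\<bar> ^ m * \<bar>(snd a - fst y * fst a) - (snd b - fst y * fst b)\<bar>)"
      by (simp add: A_def B_def)
  qed
  finally show ?thesis .
qed

lemma \<gamma>_dominated_finite:
  assumes "\<And>y. h y \<le> C * (fst y ^ 2 + snd y ^ 2 + 1)" "0 \<le> C"
  shows "(\<integral>\<^sup>+y. ennreal (\<gamma> y * h y) \<partial>lborel) < \<infinity>"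
proof -
  have [measurable]: "(fst :: real \<times> real \<Rightarrow> real) \<in> borel_measurable borel"
     "(snd :: real \<times> real \<Rightarrow> real) \<in> borel_measurable borel"
    by (intro borel_measurable_continuous_onI continuous_intros)+
  have "(\<integral>\<^sup>+y. ennreal (\<gamma> y * h y) \<partial>lborel) \<le>
      (\<integral>\<^sup>+y. ennreal C * ennreal ((fst y ^ 2 + snd y ^ 2 + 1) * \<gamma> y) \<partial>lborel)"
  proof (rule nn_integral_mono)
    fix y
    have "\<gamma> y * h y \<le> \<gamma> y * (C * (fst y ^ 2 + snd y ^ 2 + 1))"
      by (intro mult_left_mono assms \<gamma>_nonneg)
    then show "ennreal (\<gamma> y * h y) \<le> ennreal C * ennreal ((fst y ^ 2 + snd y ^ 2 + 1) * \<gamma> y)"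
      using assms(2) \<gamma>_nonneg[of y] by (subst ennreal_mult[symmetric]) (auto simp: mult_ac intro!: ennreal_leI)
  qed
  also have "\<dots> = ennreal C * (\<integral>\<^sup>+y. ennreal ((fst y ^ 2 + snd y ^ 2 + 1) * \<gamma> y) \<partial>lborel)"
    by (rule nn_integral_cmult) measurable
  also have "\<dots> < \<infinity>" using \<gamma>_moment by (simp add: ennreal_mult_less_top)
  finally show ?thesis .
qed

text \<open>The length of the position interval is at most linear in the velocity and the kernel is
  linear in the mark, so second moments of \<open>\<gamma>\<close> suffice.\<close>

lemma integrable_kern: "integrable lborel (\<lambda>p. f p * kern a p)"
proof (rule integrableI_bounded)
  have "(\<integral>\<^sup>+p. ennreal (norm (f p * kern a p)) \<partial>lborel) =
     (\<integral>\<^sup>+p. ennreal (f p * \<bar>snd (snd p)\<bar> ^ 1 * \<bar>side a p - side (0, 0) p\<bar>) \<partial>lborel)"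
    by (intro nn_integral_cong) (simp add: kern_eq abs_mult f_nonneg mult.assoc)
  also have "\<dots> \<le> (\<integral>\<^sup>+y. ennreal (\<gamma> y * (\<bar>snd y\<bar> * \<bar>snd a - fst y * fst a\<bar>)) \<partial>lborel)"
    using nn_integral_side_le[of 1 a "(0, 0)"] by (simp add: mult.assoc)
  also have "\<dots> < \<infinity>"
  proof (rule \<gamma>_dominated_finite)
    fix y :: "real \<times> real"
    have "\<bar>snd y\<bar> * \<bar>snd a - fst y * fst a\<bar> \<le> \<bar>snd y\<bar> * (\<bar>snd a\<bar> + \<bar>fst y\<bar> * \<bar>fst a\<bar>)"
      by (intro mult_left_mono) (auto simp: abs_mult[symmetric])
    also have "\<dots> = \<bar>snd a\<bar> * \<bar>snd y\<bar> + \<bar>fst a\<bar> * (\<bar>snd y\<bar> * \<bar>fst y\<bar>)"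
      by (simp add: algebra_simps)
    also have "\<dots> \<le> \<bar>snd a\<bar> * (fst y ^ 2 + snd y ^ 2 + 1) + \<bar>fst a\<bar> * (fst y ^ 2 + snd y ^ 2 + 1)"
    proof (intro add_mono mult_left_mono)
      have "0 \<le> (\<bar>snd y\<bar> - 1)\<^sup>2" "0 \<le> (\<bar>snd y\<bar> - \<bar>fst y\<bar>)\<^sup>2" by auto
      then show "\<bar>snd y\<bar> \<le> fst y ^ 2 + snd y ^ 2 + 1" "\<bar>snd y\<bar> * \<bar>fst y\<bar> \<le> fst y ^ 2 + snd y ^ 2 + 1"
        unfolding power2_diff power2_abs
        using zero_le_power2[of "fst y"] zero_le_power2[of "snd y"] by (simp; linarith)+
    qed auto
    finally show "\<bar>snd y\<bar> * \<bar>snd a - fst y * fst a\<bar> \<le>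
        (\<bar>snd a\<bar> + \<bar>fst a\<bar>) * (fst y ^ 2 + snd y ^ 2 + 1)"
      by (simp add: distrib_right)
  qed simp
  finally show "(\<integral>\<^sup>+p. ennreal (norm (f p * kern a p)) \<partial>lborel) < \<infinity>" .
qed simp

text \<open>At equal times the interval length does not depend on the velocity, so the second moment
  of the mark suffices; at different times the bound would contain r^2 |v|.\<close>

lemma integrable_kern_diff_same_time:
  assumes "fst a = fst b"
  shows "integrable lborel (\<lambda>p. f p * (kern a p - kern b p)\<^sup>2)"
proof (rule integrableI_bounded)
  have "(\<integral>\<^sup>+p. ennreal (norm (f p * (kern a p - kern b p)\<^sup>2)) \<partial>lborel) =
     (\<integral>\<^sup>+p. ennreal (f p * \<bar>snd (snd p)\<bar> ^ 2 * \<bar>side a p - side b p\<bar>) \<partial>lborel)"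
    by (intro nn_integral_cong) (simp add: kern_diff side_def power_mult_distrib f_nonneg)
  also have "\<dots> \<le> (\<integral>\<^sup>+y. ennreal (\<gamma> y * \<bar>snd y\<bar> ^ 2 *
      \<bar>(snd a - fst y * fst a) - (snd b - fst y * fst b)\<bar>) \<partial>lborel)"
    by (rule nn_integral_side_le)
  also have "\<dots> = (\<integral>\<^sup>+y. ennreal (\<gamma> y * (\<bar>snd a - snd b\<bar> * snd y ^ 2)) \<partial>lborel)"
    using assms by (simp add: mult_ac)
  also have "\<dots> < \<infinity>"
    by (rule \<gamma>_dominated_finite[where C="\<bar>snd a - snd b\<bar>"]) (auto intro!: mult_left_mono)
  finally show "(\<integral>\<^sup>+p. ennreal (norm (f p * (kern a p - kern b p)\<^sup>2)) \<partial>lborel) < \<infinity>" .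
qed simp

end

section \<open>The Gaussian limit\<close>

lemma centered_gaussian_rv_moments:
  assumes "prob_space M" and Y: "centered_gaussian_rv M Y"
  shows "integrable M Y" "integral\<^sup>L M Y = 0" "integrable M (\<lambda>\<omega>. (Y \<omega>)\<^sup>2)"
    "(CLINT \<omega>|M. iexp (Y \<omega>)) = exp (- of_real (\<integral>\<omega>. (Y \<omega>)\<^sup>2 \<partial>M) / 2)"
proof -
  interpret prob_space M by fact
  have [measurable]: "Y \<in> borel_measurable M" using Y by (simp add: centered_gaussian_rv_def)
  have "integrable M Y \<and> integral\<^sup>L M Y = 0 \<and> integrable M (\<lambda>\<omega>. (Y \<omega>)\<^sup>2) \<and>
    (CLINT \<omega>|M. iexp (Y \<omega>)) = exp (- of_real (\<integral>\<omega>. (Y \<omega>)\<^sup>2 \<partial>M) / 2)"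
    using Y unfolding centered_gaussian_rv_def
  proof (elim conjE disjE exE)
    assume zero: "AE \<omega> in M. Y \<omega> = 0"
    have "integrable M Y \<longleftrightarrow> integrable M (\<lambda>_. 0 :: real)"
      by (rule integrable_cong_AE) (use zero in auto)
    moreover have "integral\<^sup>L M Y = (\<integral>_. 0 \<partial>M)"
      by (rule integral_cong_AE) (use zero in auto)
    moreover have "integrable M (\<lambda>\<omega>. (Y \<omega>)\<^sup>2) \<longleftrightarrow> integrable M (\<lambda>_. 0 :: real)"
      by (rule integrable_cong_AE) (use zero in auto)
    moreover have "(\<integral>\<omega>. (Y \<omega>)\<^sup>2 \<partial>M) = (\<integral>_. 0 \<partial>M)"
      by (rule integral_cong_AE) (use zero in auto)
    moreover have "(CLINT \<omega>|M. iexp (Y \<omega>)) = (CLINT \<omega>|M. 1)"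
      by (rule integral_cong_AE) (use zero in auto)
    ultimately show ?thesis by (simp add: prob_space)
  next
    fix \<sigma> :: real
    assume \<sigma>: "0 < \<sigma>" and D: "distributed M lborel Y (normal_density 0 \<sigma>)"
    have int1: "integrable M Y"
      using integrable_normal_moment[OF \<sigma>, of 0 1]
      by (subst distributed_integrable[OF D, of "\<lambda>x. x", symmetric]) auto
    have int2: "integrable M (\<lambda>\<omega>. (Y \<omega>)\<^sup>2)"
      using integrable_normal_moment[OF \<sigma>, of 0 2]
      by (subst distributed_integrable[OF D, of "\<lambda>x. x\<^sup>2", symmetric]) auto
    have mean: "integral\<^sup>L M Y = 0"
      by (rule normal_distributed_expectation[OF \<sigma> D])
    have var: "(\<integral>\<omega>. (Y \<omega>)\<^sup>2 \<partial>M) = \<sigma>\<^sup>2"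
      using normal_distributed_variance[OF \<sigma> D] mean by simp
    \<comment> \<open>Standardizing reduces to the known characteristic function of the standard
      normal law, evaluated at \<open>\<sigma>\<close>.\<close>
    have "distributed M lborel (\<lambda>\<omega>. (Y \<omega> - 0) / \<sigma>) std_normal_density"
      using D normal_standard_normal_convert[OF \<sigma>, of Y 0] by simp
    then have S: "distr M lborel (\<lambda>\<omega>. Y \<omega> / \<sigma>) = density lborel std_normal_density"
      by (simp add: distributed_def)
    have "(CLINT \<omega>|M. iexp (Y \<omega>)) = (CLINT \<omega>|M. iexp (\<sigma> * (Y \<omega> / \<sigma>)))"
      using \<sigma> by simp
    also have "\<dots> = (CLINT x|distr M lborel (\<lambda>\<omega>. Y \<omega> / \<sigma>). iexp (\<sigma> * x))"
      by (subst integral_distr) auto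
    also have "\<dots> = char std_normal_distribution \<sigma>"
      unfolding S char_def ..
    also have "\<dots> = exp (- of_real (\<sigma>\<^sup>2) / 2)"
      by (simp add: char_std_normal_distribution exp_of_real[symmetric])
    finally show ?thesis using int1 int2 mean var by simp
  qed
  then show "integrable M Y" "integral\<^sup>L M Y = 0" "integrable M (\<lambda>\<omega>. (Y \<omega>)\<^sup>2)"
    "(CLINT \<omega>|M. iexp (Y \<omega>)) = exp (- of_real (\<integral>\<omega>. (Y \<omega>)\<^sup>2 \<partial>M) / 2)" by auto
qed

text \<open>From 2 |Y Z| <= Y^2 + Z^2. The weight \<open>w\<close> is \<open>f\<close> for the
  kernels and 1 for the Gaussian variables.\<close>

lemma integrable_mult_of_squares:
  fixes Y Z :: "'a \<Rightarrow> real"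
  assumes [measurable]: "Y \<in> borel_measurable M" "Z \<in> borel_measurable M"
    and "integrable M (\<lambda>\<omega>. w \<omega> * (Y \<omega>)\<^sup>2)" "integrable M (\<lambda>\<omega>. w \<omega> * (Z \<omega>)\<^sup>2)"
    and [measurable]: "w \<in> borel_measurable M" and w: "\<And>\<omega>. 0 \<le> w \<omega>"
  shows "integrable M (\<lambda>\<omega>. w \<omega> * (Y \<omega> * Z \<omega>))"
proof (rule Bochner_Integration.integrable_bound)
  show "integrable M (\<lambda>\<omega>. w \<omega> * (Y \<omega>)\<^sup>2 + w \<omega> * (Z \<omega>)\<^sup>2)" using assms by simp
  show "AE \<omega> in M. norm (w \<omega> * (Y \<omega> * Z \<omega>)) \<le> norm (w \<omega> * (Y \<omega>)\<^sup>2 + w \<omega> * (Z \<omega>)\<^sup>2)"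
  proof (rule AE_I2)
    fix \<omega>
    have "0 \<le> (\<bar>Y \<omega>\<bar> - \<bar>Z \<omega>\<bar>)\<^sup>2" by simp
    then have "2 * \<bar>Y \<omega> * Z \<omega>\<bar> \<le> (Y \<omega>)\<^sup>2 + (Z \<omega>)\<^sup>2"
      unfolding power2_diff by (simp add: abs_mult)
    then have "\<bar>Y \<omega> * Z \<omega>\<bar> \<le> (Y \<omega>)\<^sup>2 + (Z \<omega>)\<^sup>2" by linarith
    then have "w \<omega> * \<bar>Y \<omega> * Z \<omega>\<bar> \<le> w \<omega> * ((Y \<omega>)\<^sup>2 + (Z \<omega>)\<^sup>2)"
      by (intro mult_left_mono w)
    then show "norm (w \<omega> * (Y \<omega> * Z \<omega>)) \<le> norm (w \<omega> * (Y \<omega>)\<^sup>2 + w \<omega> * (Z \<omega>)\<^sup>2)"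
      using w[of \<omega>] by (simp add: abs_mult distrib_left)
  qed
qed simp

context line_intensity
begin

text \<open>By Fubini some position would have a section on which f r^2 vanishes almost everywhere;
  there r f vanishes too, contradicting positivity of \<open>sigma_f\<close>.\<close>

lemma not_AE_zero: "\<not> (AE p in lborel. f p * (snd (snd p))\<^sup>2 = 0)"
proof
  assume "AE p in lborel. f p * (snd (snd p))\<^sup>2 = 0"
  then have "AE p in lborel \<Otimes>\<^sub>M lborel. f p * (snd (snd p))\<^sup>2 = 0"
    unfolding lborel_prod .
  then have "AE x in lborel. AE y in lborel. f (x, y) * (snd (snd (x, y)))\<^sup>2 = 0"
    by (rule lborel_pair.AE_pair)
  moreover have "ae_filter (lborel :: real measure) \<noteq> bot"
    by (simp add: ae_filter_eq_bot_iff)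
  ultimately obtain x where x: "AE y in lborel. f (x, y) * (snd y)\<^sup>2 = 0"
    using eventually_happens' by fastforce
  have "sigma_f f x = 0"
    unfolding sigma_f_def
    by (rule integral_eq_zero_AE) (use x in \<open>eventually_elim, auto\<close>)
  then show False using sigma_pos[of x] by simp
qed

text \<open>The class \<open>\<F>\<close> does not bound \<open>\<integral> f r\<^sup>2\<close> over the lines that meet
  a given segment. If it is infinite for \<open>[(0,0), (t,x)]\<close>, then it is infinite for all
  \<open>x\<close>, so \<open>line_dist\<close> takes the junk value 0 there and \<open>\<eta> (t, x) = 0\<close> for
  all \<open>x\<close>; then the genuine distance between any two points at time \<open>t\<close> vanishes,
  which forces \<open>f r\<^sup>2 = 0\<close> almost everywhere.\<close>
lemma integrable_kern_square:
  assumes \<eta>: "levy_chentsov_field M' (line_dist f) \<eta>"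
  shows "integrable lborel (\<lambda>p. f p * (kern a p)\<^sup>2)"
proof (rule ccontr)
  assume a: "\<not> integrable lborel (\<lambda>p. f p * (kern a p)\<^sup>2)"
  interpret M': prob_space M'
    using \<eta> by (simp add: levy_chentsov_field_def centered_gaussian_process_def)
  have gauss: "centered_gaussian_rv M' (\<eta> b)" for b
    using \<eta>[unfolded levy_chentsov_field_def centered_gaussian_process_def, THEN conjunct1,
        THEN conjunct2, rule_format, of "{b}" "\<lambda>_. 1"] by simp
  have cov: "covariance M' (\<eta> b) (\<eta> c) =
      (line_dist f (0, 0) b + line_dist f (0, 0) c - line_dist f b c) / 2" for b c
    using \<eta> unfolding levy_chentsov_field_def by blast
  have dist0: "line_dist f (0, 0) b = 0" if "fst b = fst a" for b
  proof -
    have "\<not> integrable lborel (\<lambda>p. f p * (kern b p)\<^sup>2)"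
    proof
      assume b: "integrable lborel (\<lambda>p. f p * (kern b p)\<^sup>2)"
      have "integrable lborel (\<lambda>p. f p * (kern a p)\<^sup>2)"
      proof (rule Bochner_Integration.integrable_bound)
        show "integrable lborel (\<lambda>p. 2 * (f p * (kern b p)\<^sup>2) + 2 * (f p * (kern a p - kern b p)\<^sup>2))"
          using b integrable_kern_diff_same_time[of a b] that by simp
        show "AE p in lborel. norm (f p * (kern a p)\<^sup>2) \<le>
            norm (2 * (f p * (kern b p)\<^sup>2) + 2 * (f p * (kern a p - kern b p)\<^sup>2))"
        proof (rule AE_I2)
          fix p
          have "0 \<le> (2 * kern b p - kern a p)\<^sup>2" by simp
          then have "(kern a p)\<^sup>2 \<le> 2 * (kern b p)\<^sup>2 + 2 * (kern a p - kern b p)\<^sup>2"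
            by (simp add: power2_eq_square algebra_simps)
          then have "f p * (kern a p)\<^sup>2 \<le> f p * (2 * (kern b p)\<^sup>2 + 2 * (kern a p - kern b p)\<^sup>2)"
            by (intro mult_left_mono f_nonneg)
          then show "norm (f p * (kern a p)\<^sup>2) \<le>
            norm (2 * (f p * (kern b p)\<^sup>2) + 2 * (f p * (kern a p - kern b p)\<^sup>2))"
            using f_nonneg[of p] by (simp add: algebra_simps)
        qed
      qed simp
      with a show False by simp
    qed
    then show ?thesis
      by (simp add: line_dist_eq kern_origin[simplified] not_integrable_integral_eq)
  qed
  have "covariance M' (\<eta> a) (\<eta> a) = 0"
    unfolding cov dist0[OF refl] by (simp add: line_dist_eq)
  then have var: "(\<integral>\<omega>. (\<eta> a \<omega>)\<^sup>2 \<partial>M') = 0"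
    using centered_gaussian_rv_moments(2)[OF M'.prob_space_axioms gauss[of a]]
    by (simp add: covariance_def power2_eq_square)
  have "AE \<omega> in M'. (\<eta> a \<omega>)\<^sup>2 = 0"
    using var centered_gaussian_rv_moments(3)[OF M'.prob_space_axioms gauss[of a]]
    by (subst (asm) integral_nonneg_eq_0_iff_AE) auto
  then have zero: "AE \<omega> in M'. \<eta> a \<omega> = 0" by simp
  \<comment> \<open>\<open>\<eta> a\<close> is almost surely 0, hence uncorrelated with every
    \<open>\<eta> b\<close>. As the distances from the origin default to 0, only
    \<open>line_dist f a b\<close> is left, and at equal times it is a convergent integral.\<close>
  have dist_zero: "line_dist f a b = 0" if "fst b = fst a" for b
  proof -
    have "covariance M' (\<eta> a) (\<eta> b) = 0"
      unfolding covariance_def centered_gaussian_rv_moments(2)[OF M'.prob_space_axioms gauss]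
      by (rule integral_eq_zero_AE) (use zero in \<open>eventually_elim, auto\<close>)
    then show ?thesis unfolding cov dist0[OF refl] dist0[OF that] by simp
  qed
  have AE: "AE p in lborel. f p * (kern a p - kern b p)\<^sup>2 = 0" if "fst b = fst a" for b
    using dist_zero[OF that] integrable_kern_diff_same_time[of a b] that f_nonneg
    unfolding line_dist_eq[OF f_measurable]
    by (subst (asm) integral_nonneg_eq_0_iff_AE) auto
  have "AE p in lborel. \<forall>n::int. f p * (kern a p - kern (fst a, snd a + of_int n) p)\<^sup>2 = 0"
    by (subst AE_all_countable) (intro allI AE, simp)
  then have "AE p in lborel. f p * (snd (snd p))\<^sup>2 = 0"
  proof eventually_elim
    case (elim p)
    have shift: "offset (fst a, snd a + c) p = offset a p - c" for c
      by (simp add: offset_def)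
    \<comment> \<open>Integer vertical shifts suffice: shifting by the floor of the offset, or by
      one more if the offset is nonnegative, moves the point to the other side. A countable family
      keeps the exceptional set null.\<close>
    obtain n :: int where "side a p \<noteq> side (fst a, snd a + of_int n) p"
    proof (cases "offset a p < 0")
      case True
      have "side a p \<noteq> side (fst a, snd a + of_int \<lfloor>offset a p\<rfloor>) p"
        using True by (simp add: side_def shift not_less)
      then show ?thesis by (rule that)
    next
      case False
      have "offset a p < of_int (\<lfloor>offset a p\<rfloor> + 1)" by linarith
      then have "side a p \<noteq> side (fst a, snd a + of_int (\<lfloor>offset a p\<rfloor> + 1)) p"
        using False by (simp add: side_def shift)
      then show ?thesis by (rule that)
    qed
    with elim[rule_format, of n] show ?case by (simp add: kern_diff del: fst_conv snd_conv)
  qed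
  with not_AE_zero show False by simp
qed

lemma integrable_kern_mult:
  assumes \<eta>: "levy_chentsov_field M' (line_dist f) \<eta>"
  shows "integrable lborel (\<lambda>p. f p * (kern a p * kern b p))"
  by (rule integrable_mult_of_squares[OF _ _ integrable_kern_square[OF \<eta>] integrable_kern_square[OF \<eta>]])
     (auto simp: f_nonneg)

lemma gaussian_char:
  fixes pts :: "'i::finite \<Rightarrow> real \<times> real"
  assumes \<eta>: "levy_chentsov_field M' (line_dist f) \<eta>"
  shows "(CLINT \<omega>|M'. iexp (\<Sum>i\<in>UNIV. w i * \<eta> (pts i) \<omega>)) =
    exp (- of_real (\<integral>p. f p * (\<Sum>i\<in>UNIV. w i * kern (pts i) p)\<^sup>2 \<partial>lborel) / 2)"
proof -
  interpret M': prob_space M'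
    using \<eta> by (simp add: levy_chentsov_field_def centered_gaussian_process_def)
  have gauss': "centered_gaussian_rv M' (\<lambda>\<omega>. \<Sum>i\<in>S. c i * \<eta> i \<omega>)" if "finite S" for S c
    using \<eta> that by (simp add: levy_chentsov_field_def centered_gaussian_process_def)
  have gauss: "centered_gaussian_rv M' (\<eta> b)" for b
    using gauss'[of "{b}" "\<lambda>_. 1"] by simp
  note mom = centered_gaussian_rv_moments[OF M'.prob_space_axioms gauss]
  have [measurable]: "\<eta> b \<in> borel_measurable M'" for b
    using gauss[of b] by (simp add: centered_gaussian_rv_def)
  have cov: "(\<integral>\<omega>. \<eta> a \<omega> * \<eta> b \<omega> \<partial>M') = (\<integral>p. f p * (kern a p * kern b p) \<partial>lborel)" for a b
  proof -
    note sq = integrable_kern_square[OF \<eta>]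
    have "(\<integral>\<omega>. \<eta> a \<omega> * \<eta> b \<omega> \<partial>M') = covariance M' (\<eta> a) (\<eta> b)"
      by (simp add: covariance_def mom(2))
    also have "\<dots> = (line_dist f (0, 0) a + line_dist f (0, 0) b - line_dist f a b) / 2"
      using \<eta> unfolding levy_chentsov_field_def by blast
    also have "\<dots> = ((\<integral>p. f p * (kern a p)\<^sup>2 \<partial>lborel) + (\<integral>p. f p * (kern b p)\<^sup>2 \<partial>lborel)
        - line_dist f a b) / 2"
      by (simp add: line_dist_eq kern_origin[simplified])
    \<comment> \<open>Polarization; splitting the integral below relies on
      \<open>integrable_kern_square\<close>.\<close>
    also have "line_dist f a b = (\<integral>p. f p * (kern a p)\<^sup>2 + f p * (kern b p)\<^sup>2 - 2 * (f p * (kern a p * kern b p)) \<partial>lborel)"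
      unfolding line_dist_eq[OF f_measurable]
      by (intro Bochner_Integration.integral_cong refl) (simp add: power2_eq_square algebra_simps)
    also have "\<dots> = (\<integral>p. f p * (kern a p)\<^sup>2 \<partial>lborel) + (\<integral>p. f p * (kern b p)\<^sup>2 \<partial>lborel)
        - 2 * (\<integral>p. f p * (kern a p * kern b p) \<partial>lborel)"
      using sq integrable_kern_mult[OF \<eta>] by simp
    finally show ?thesis by simp
  qed
  \<comment> \<open>\<open>pts\<close> may repeat points, while Gaussianity is stated for sums over
    sets, so the weights of coinciding points are added.\<close>
  define S where "S = range pts"
  define c where "c a = (\<Sum>i | pts i = a. w i)" for a
  have sum_eq: "(\<Sum>i\<in>UNIV. w i * \<eta> (pts i) \<omega>) = (\<Sum>a\<in>S. c a * \<eta> a \<omega>)" for \<omega>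
    unfolding S_def c_def sum_distrib_right
    by (subst sum.image_gen[of UNIV _ pts]) auto
  let ?Y = "\<lambda>\<omega>. \<Sum>i\<in>UNIV. w i * \<eta> (pts i) \<omega>"
  have Y: "centered_gaussian_rv M' ?Y"
    unfolding sum_eq by (rule gauss') (simp add: S_def)
  have prod': "integrable M' (\<lambda>\<omega>. \<eta> a \<omega> * \<eta> b \<omega>)" for a b
    using integrable_mult_of_squares[of "\<eta> a" M' "\<eta> b" "\<lambda>_. 1"] mom(3) by simp
  have "(\<integral>\<omega>. (?Y \<omega>)\<^sup>2 \<partial>M') = (\<integral>\<omega>. (\<Sum>i\<in>UNIV. \<Sum>j\<in>UNIV. (w i * w j) * (\<eta> (pts i) \<omega> * \<eta> (pts j) \<omega>)) \<partial>M')"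
    by (simp add: power2_eq_square sum_product mult_ac)
  also have "\<dots> = (\<Sum>i\<in>UNIV. \<Sum>j\<in>UNIV. (w i * w j) * (\<integral>p. f p * (kern (pts i) p * kern (pts j) p) \<partial>lborel))"
    using prod' by (simp add: Bochner_Integration.integral_sum Bochner_Integration.integrable_sum cov)
  also have "\<dots> = (\<integral>p. (\<Sum>i\<in>UNIV. \<Sum>j\<in>UNIV. (w i * w j) * (f p * (kern (pts i) p * kern (pts j) p))) \<partial>lborel)"
    using integrable_kern_mult[OF \<eta>] by (simp add: Bochner_Integration.integral_sum Bochner_Integration.integrable_sum)
  also have "\<dots> = (\<integral>p. f p * (\<Sum>i\<in>UNIV. w i * kern (pts i) p)\<^sup>2 \<partial>lborel)"
    by (simp add: power2_eq_square sum_product sum_distrib_left mult_ac)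
  finally show ?thesis
    using centered_gaussian_rv_moments(4)[OF M'.prob_space_axioms Y] by simp
qed

end

section \<open>Convergence of the characteristic functions\<close>

text \<open>The second-order Taylor remainder is at most |x|^3 / 6; after division by the square of
  \<open>s n\<close> one factor \<open>s n\<close> remains.\<close>

lemma tendsto_iexp_quadratic:
  fixes y :: real
  assumes s: "s \<longlonglongrightarrow> 0" "\<And>n. s n \<noteq> (0::real)"
  shows "(\<lambda>n. (iexp (s n * y) - 1 - \<i> * of_real (s n * y)) / of_real ((s n)\<^sup>2)) \<longlonglongrightarrow> - of_real (y\<^sup>2) / 2"
proof (rule Lim_transform[OF tendsto_const], rule Lim_null_comparison)
  show "\<forall>\<^sub>F n in sequentially. norm ((iexp (s n * y) - 1 - \<i> * of_real (s n * y)) / of_real ((s n)\<^sup>2) -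
      - of_real (y\<^sup>2) / 2) \<le> \<bar>s n\<bar> * \<bar>y\<bar> ^ 3 / 6"
  proof (rule always_eventually, rule allI)
    fix n
    let ?x = "s n * y"
    have "cmod (iexp ?x - 1 - \<i> * of_real ?x + of_real (?x\<^sup>2) / 2) \<le> \<bar>?x\<bar> ^ 3 / 6"
      using iexp_approx1[of ?x 2]
      by (simp add: numeral_eq_Suc algebra_simps power_mult_distrib)
    moreover have "(iexp ?x - 1 - \<i> * of_real ?x) / of_real ((s n)\<^sup>2) - - of_real (y\<^sup>2) / 2 =
        (iexp ?x - 1 - \<i> * of_real ?x + of_real (?x\<^sup>2) / 2) / of_real ((s n)\<^sup>2)"
      using s(2)[of n] by (simp add: field_simps power_mult_distrib)
    ultimately have "norm ((iexp ?x - 1 - \<i> * of_real ?x) / of_real ((s n)\<^sup>2) - - of_real (y\<^sup>2) / 2)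
        \<le> (\<bar>?x\<bar> ^ 3 / 6) / (s n)\<^sup>2"
      by (simp only: norm_divide norm_minus_cancel norm_of_real abs_power2) (intro divide_right_mono, simp_all)
    also have "\<dots> = \<bar>s n\<bar> * \<bar>y\<bar> ^ 3 / 6"
    proof -
      have "\<bar>?x\<bar> ^ 3 = \<bar>s n\<bar> * \<bar>y\<bar> ^ 3 * (s n)\<^sup>2"
        by (simp add: abs_mult power_mult_distrib power3_eq_cube power2_eq_square abs_mult_self_eq mult_ac)
      then show ?thesis using s(2)[of n] by simp
    qed
    finally show "norm ((iexp ?x - 1 - \<i> * of_real ?x) / of_real ((s n)\<^sup>2) - - of_real (y\<^sup>2) / 2)
        \<le> \<bar>s n\<bar> * \<bar>y\<bar> ^ 3 / 6" .
  qed
  show "(\<lambda>n. \<bar>s n\<bar> * \<bar>y\<bar> ^ 3 / 6) \<longlonglongrightarrow> 0"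
    using tendsto_mult_right[OF tendsto_rabs_zero[OF s(1)], of "\<bar>y\<bar> ^ 3 / 6"] by simp
qed

lemma infsum_sum_swap:
  fixes h :: "'i \<Rightarrow> 'b \<Rightarrow> real"
  assumes "\<And>i. i \<in> I \<Longrightarrow> h i summable_on A"
  shows "infsum (\<lambda>p. \<Sum>i\<in>I. h i p) A = (\<Sum>i\<in>I. infsum (h i) A)"
  using assms
  by (simp add: summable_on_iff_integrable_count_space infsum_eq_integral_count_space
      Bochner_Integration.integral_sum Bochner_Integration.integrable_sum)

lemma borel_measurable_vec_lambda:
  fixes Y :: "'n::finite \<Rightarrow> 'a \<Rightarrow> real"
  assumes "\<And>i. Y i \<in> borel_measurable M"
  shows "(\<lambda>\<omega>. \<chi> i. Y i \<omega>) \<in> borel_measurable M"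
  using assms by (subst borel_measurable_euclidean_space) (auto simp: Basis_vec_def inner_axis)

context line_poisson
begin

lemma H_eps_measurable [measurable]: "(\<lambda>\<omega>. H_eps \<epsilon> X t x \<omega>) \<in> borel_measurable M"
proof -
  interpret P: point_config M "X_eps \<epsilon> X" by (rule point_config_X_eps)
  have "kernel_H t x \<in> borel_measurable borel" using kern_measurable[of "(t, x)"] by simp
  then show ?thesis unfolding H_eps_def by measurable
qed

lemma eta_eps_measurable [measurable]: "(\<lambda>\<omega>. eta_eps f \<epsilon> X a \<omega>) \<in> borel_measurable M"
  unfolding eta_eps_def by measurable

text \<open>Linearity merges all points into one sum of sqrt eps times \<open>g\<close>, and the
  centring becomes the linear term. Writing eps as the square of sqrt eps matches
  \<open>tendsto_iexp_quadratic\<close>.\<close>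

lemma eta_eps_char:
  fixes pts :: "'i::finite \<Rightarrow> real \<times> real" and w :: "'i \<Rightarrow> real"
  assumes "0 < \<epsilon>"
  defines "g \<equiv> \<lambda>p. \<Sum>i\<in>UNIV. w i * kern (pts i) p"
  shows "(CLINT \<omega>|M. iexp (\<Sum>i\<in>UNIV. w i * eta_eps f \<epsilon> X (pts i) \<omega>)) =
    exp (CLINT p|lborel. f p *\<^sub>R
      ((iexp (sqrt \<epsilon> * g p) - 1 - \<i> * of_real (sqrt \<epsilon> * g p)) / of_real ((sqrt \<epsilon>)\<^sup>2)))"
proof -
  interpret P: point_config M "X_eps \<epsilon> X" by (rule point_config_X_eps)
  have g_meas [measurable]: "g \<in> borel_measurable borel" unfolding g_def by measurable
  have fg_eq: "f p * g p = (\<Sum>i\<in>UNIV. w i * (f p * kern (pts i) p))" for p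
    by (simp add: g_def sum_distrib_left mult_ac)
  have fg: "integrable lborel (\<lambda>p. f p * g p)"
    unfolding fg_eq by (intro Bochner_Integration.integrable_sum integrable_mult_right integrable_kern)
  define m where "m = (\<integral>p. f p * g p \<partial>lborel)"
  have m_eq: "m = (\<Sum>i\<in>UNIV. w i * H_mean f (fst (pts i)) (snd (pts i)))"
    unfolding m_def fg_eq H_mean_def
    by (subst Bochner_Integration.integral_sum) (auto intro: integrable_kern)
  let ?s = "sqrt \<epsilon>"
  have s: "0 < ?s" and s2: "?s\<^sup>2 = \<epsilon>" using \<open>0 < \<epsilon>\<close> by auto
  have sg_meas: "(\<lambda>p. ?s * g p) \<in> borel_measurable borel" by measurable
  have sfg: "integrable lborel (\<lambda>p. f p * (?s * g p))"
    using integrable_mult_right[OF fg, of ?s] by (simp add: mult_ac)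
  \<comment> \<open>Only almost sure: separating the infinite sum requires each kernel to be
    summable over the configuration. The factor eps / sqrt eps equals sqrt eps.\<close>
  have AE_eq: "AE \<omega> in M. (\<Sum>i\<in>UNIV. w i * eta_eps f \<epsilon> X (pts i) \<omega>) =
      infsum (\<lambda>p. ?s * g p) (X_eps \<epsilon> X \<omega>) - m / ?s"
  proof -
    have "AE \<omega> in M. kern (pts i) summable_on X_eps \<epsilon> X \<omega>" for i
      using AE_infsum_X_eps[OF \<open>0 < \<epsilon>\<close> kern_measurable integrable_kern] by eventually_elim auto
    then have "AE \<omega> in M. \<forall>i. kern (pts i) summable_on X_eps \<epsilon> X \<omega>"
      by (subst AE_all_countable) auto
    then show ?thesis
    proof eventually_elim
      case (elim \<omega>)
      let ?P = "X_eps \<epsilon> X \<omega>"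
      have "infsum (\<lambda>p. ?s * g p) ?P = infsum (\<lambda>p. \<Sum>i\<in>UNIV. (?s * w i) * kern (pts i) p) ?P"
        by (simp add: g_def sum_distrib_left mult_ac)
      also have "\<dots> = (\<Sum>i\<in>UNIV. infsum (\<lambda>p. (?s * w i) * kern (pts i) p) ?P)"
        using elim by (intro infsum_sum_swap summable_on_cmult_right) auto
      also have "\<dots> = (\<Sum>i\<in>UNIV. ?s * w i * infsum (kern (pts i)) ?P)"
        using elim by (intro sum.cong refl infsum_cmult_right) auto
      finally have *: "infsum (\<lambda>p. ?s * g p) ?P = (\<Sum>i\<in>UNIV. ?s * w i * infsum (kern (pts i)) ?P)" .
      have "(\<Sum>i\<in>UNIV. w i * eta_eps f \<epsilon> X (pts i) \<omega>) =
        (\<Sum>i\<in>UNIV. ?s * w i * infsum (kern (pts i)) ?P - w i * H_mean f (fst (pts i)) (snd (pts i)) / ?s)"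
      proof (rule sum.cong)
        fix i
        have "\<epsilon> / ?s = ?s" using s s2 by (simp add: field_simps power2_eq_square)
        then have split: "(\<epsilon> * I - h) / ?s = ?s * I - h / ?s" for I h
          by (metis diff_divide_distrib times_divide_eq_left)
        show "w i * eta_eps f \<epsilon> X (pts i) \<omega> = ?s * w i * infsum (kern (pts i)) ?P - w i * H_mean f (fst (pts i)) (snd (pts i)) / ?s"
          unfolding eta_eps_def H_eps_def split by (simp add: right_diff_distrib mult_ac)
      qed simp
      also have "\<dots> = infsum (\<lambda>p. ?s * g p) ?P - m / ?s"
        by (simp add: * m_eq sum_subtractf sum_divide_distrib)
      finally show ?case .
    qed
  qed
  have e1: "integrable lborel (\<lambda>p. f p *\<^sub>R (iexp (?s * g p) - 1))"
  proof (rule Bochner_Integration.integrable_bound[OF sfg])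
    show "AE p in lborel. norm (f p *\<^sub>R (iexp (?s * g p) - 1)) \<le> norm (f p * (?s * g p))"
      using iexp_approx1[of "?s * g _" 0] by (auto intro!: AE_I2 mult_left_mono simp: abs_mult)
  qed measurable
  have e2: "integrable lborel (\<lambda>p. \<i> * of_real (f p * (?s * g p)))"
    by (intro integrable_mult_right integrable_of_real sfg)
  have "(CLINT \<omega>|M. iexp (\<Sum>i\<in>UNIV. w i * eta_eps f \<epsilon> X (pts i) \<omega>)) =
      (CLINT \<omega>|M. exp (- \<i> * of_real (m / ?s)) * iexp (infsum (\<lambda>p. ?s * g p) (X_eps \<epsilon> X \<omega>)))"
  proof (rule integral_cong_AE)
    show "AE \<omega> in M. iexp (\<Sum>i\<in>UNIV. w i * eta_eps f \<epsilon> X (pts i) \<omega>) =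
        exp (- \<i> * of_real (m / ?s)) * iexp (infsum (\<lambda>p. ?s * g p) (X_eps \<epsilon> X \<omega>))"
      using AE_eq by eventually_elim (simp only: exp_add[symmetric], simp add: algebra_simps)
  qed measurable
  also have "\<dots> = exp (- \<i> * of_real (m / ?s)) *
      exp ((1 / \<epsilon>) *\<^sub>R (CLINT p|lborel. f p *\<^sub>R (iexp (?s * g p) - 1)))"
    by (subst integral_mult_right_zero, subst char_functional_X_eps[OF \<open>0 < \<epsilon>\<close> sg_meas sfg]) simp
  also have "\<dots> = exp ((1 / \<epsilon>) *\<^sub>R ((CLINT p|lborel. f p *\<^sub>R (iexp (?s * g p) - 1)) - (CLINT p|lborel. \<i> * of_real (f p * (?s * g p)))))"
  proof -
    have "(CLINT p|lborel. \<i> * of_real (f p * (?s * g p))) = \<i> * of_real (?s * m)"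
    proof -
      have "(\<integral>p. f p * (?s * g p) \<partial>lborel) = ?s * m"
        unfolding m_def integral_mult_right_zero[symmetric]
        by (intro Bochner_Integration.integral_cong) (auto simp: mult_ac)
      then show ?thesis by (simp only: integral_mult_right_zero integral_of_real[OF sfg])
    qed
    moreover have "(1 / \<epsilon>) *\<^sub>R (\<i> * of_real (?s * m)) = \<i> * of_real (m / ?s)"
    proof -
      have "?s * m / \<epsilon> = m / ?s" using s s2 by (simp add: field_simps power2_eq_square)
      then show ?thesis by (simp add: scaleR_conv_of_real of_real_divide[symmetric] of_real_mult[symmetric] del: of_real_mult of_real_divide)
    qed
    ultimately show ?thesis
      by (simp only: exp_add[symmetric] scaleR_diff_right) (simp add: algebra_simps)
  qed
  also have "(CLINT p|lborel. f p *\<^sub>R (iexp (?s * g p) - 1)) - (CLINT p|lborel. \<i> * of_real (f p * (?s * g p))) =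
     (CLINT p|lborel. f p *\<^sub>R (iexp (?s * g p) - 1) - \<i> * of_real (f p * (?s * g p)))"
    using e1 e2 by simp
  also have "(1 / \<epsilon>) *\<^sub>R \<dots> = (CLINT p|lborel. f p *\<^sub>R ((iexp (?s * g p) - 1 - \<i> * of_real (?s * g p)) / of_real (?s\<^sup>2)))"
    unfolding integral_scaleR_right[symmetric]
    by (intro Bochner_Integration.integral_cong refl)
       (simp only: s2, simp add: scaleR_conv_of_real field_simps)
  finally show ?thesis .
qed

lemma eta_eps_char_tendsto:
  fixes pts :: "'i::finite \<Rightarrow> real \<times> real" and E :: "nat \<Rightarrow> real"
  assumes \<eta>: "levy_chentsov_field M' (line_dist f) \<eta>"
    and E: "\<And>n. 0 < E n" "E \<longlonglongrightarrow> 0"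
  shows "(\<lambda>n. CLINT \<omega>|M. iexp (\<Sum>i\<in>UNIV. w i * eta_eps f (E n) X (pts i) \<omega>)) \<longlonglongrightarrow>
    (CLINT \<omega>|M'. iexp (\<Sum>i\<in>UNIV. w i * \<eta> (pts i) \<omega>))"
proof -
  define g where "g p = (\<Sum>i\<in>UNIV. w i * kern (pts i) p)" for p
  have g_meas [measurable]: "g \<in> borel_measurable borel" unfolding g_def by measurable
  have g2: "integrable lborel (\<lambda>p. f p * (g p)\<^sup>2)"
  proof -
    have "integrable lborel (\<lambda>p. \<Sum>i\<in>UNIV. \<Sum>j\<in>UNIV. (w i * w j) * (f p * (kern (pts i) p * kern (pts j) p)))"
      by (intro Bochner_Integration.integrable_sum integrable_mult_right integrable_kern_mult[OF \<eta>])
    then show ?thesis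
      by (simp add: g_def power2_eq_square sum_product sum_distrib_left mult_ac)
  qed
  let ?h = "\<lambda>n p. (iexp (sqrt (E n) * g p) - 1 - \<i> * of_real (sqrt (E n) * g p)) / of_real ((sqrt (E n))\<^sup>2)"
  have "(\<lambda>n. CLINT p|lborel. f p *\<^sub>R ?h n p) \<longlonglongrightarrow> (CLINT p|lborel. f p *\<^sub>R (- of_real ((g p)\<^sup>2) / 2))"
  \<comment> \<open>The Taylor bound |exp(i x) - 1 - i x| <= x^2 / 2 makes f g^2 a majorant
    independent of \<open>n\<close>.\<close>
  proof (rule integral_dominated_convergence[OF _ _ g2])
    show "AE p in lborel. (\<lambda>n. f p *\<^sub>R ?h n p) \<longlonglongrightarrow> f p *\<^sub>R (- of_real ((g p)\<^sup>2) / 2)"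
    proof (intro AE_I2 tendsto_scaleR tendsto_const tendsto_iexp_quadratic)
      show "(\<lambda>n. sqrt (E n)) \<longlonglongrightarrow> 0" using tendsto_real_sqrt[OF E(2)] by simp
      show "sqrt (E n) \<noteq> 0" for n using E(1)[of n] by simp
    qed
    show "AE p in lborel. norm (f p *\<^sub>R ?h n p) \<le> f p * (g p)\<^sup>2" for n
    proof (rule AE_I2)
      fix p
      let ?x = "sqrt (E n) * g p"
      have "cmod (iexp ?x - 1 - \<i> * of_real ?x) \<le> ?x\<^sup>2 / 2"
        using iexp_approx1[of ?x 1] by (simp add: numeral_eq_Suc algebra_simps)
      also have "\<dots> \<le> ?x\<^sup>2" by simp
      finally have "cmod (?h n p) \<le> (g p)\<^sup>2"
        using E(1)[of n] by (simp add: norm_divide power_mult_distrib divide_le_eq mult.commute)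
      then show "norm (f p *\<^sub>R ?h n p) \<le> f p * (g p)\<^sup>2"
        using f_nonneg[of p] by (simp add: mult_left_mono)
    qed
  qed measurable
  then have lim: "(\<lambda>n. exp (CLINT p|lborel. f p *\<^sub>R ?h n p)) \<longlonglongrightarrow> exp (CLINT p|lborel. f p *\<^sub>R (- of_real ((g p)\<^sup>2) / 2))"
    by (rule tendsto_exp)
  have val: "(CLINT p|lborel. f p *\<^sub>R (- of_real ((g p)\<^sup>2) / 2)) =
      - of_real (\<integral>p. f p * (g p)\<^sup>2 \<partial>lborel) / 2"
  proof -
    have "(CLINT p|lborel. f p *\<^sub>R (- of_real ((g p)\<^sup>2) / 2)) = (CLINT p|lborel. of_real (- (f p * (g p)\<^sup>2) / 2))"
      by (intro Bochner_Integration.integral_cong) (auto simp: scaleR_conv_of_real)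
    also have "\<dots> = of_real (\<integral>p. - (f p * (g p)\<^sup>2) / 2 \<partial>lborel)"
      by (rule integral_of_real) (use g2 in simp)
    finally show ?thesis by simp
  qed
  show ?thesis
    using lim unfolding eta_eps_char[OF E(1)] gaussian_char[OF \<eta>] val unfolding g_def .
qed

theorem eta_eps_conv_law:
  fixes pts :: "'n::finite \<Rightarrow> real \<times> real"
  assumes \<eta>: "levy_chentsov_field M' (line_dist f) \<eta>"
  shows "conv_law_at0 M (\<lambda>\<epsilon> \<omega>. \<chi> i. eta_eps f \<epsilon> X (pts i) \<omega>) M' (\<lambda>\<omega>. \<chi> i. \<eta> (pts i) \<omega>)"
  unfolding conv_law_at0_def
proof (intro allI impI)
  fix \<phi> :: "real ^ 'n \<Rightarrow> real"
  assume cont: "continuous_on UNIV \<phi>" and bdd: "bounded (range \<phi>)"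
  interpret M': prob_space M'
    using \<eta> by (simp add: levy_chentsov_field_def centered_gaussian_process_def)
  have "centered_gaussian_rv M' (\<eta> b)" for b
    using \<eta>[unfolded levy_chentsov_field_def centered_gaussian_process_def, THEN conjunct1,
        THEN conjunct2, rule_format, of "{b}" "\<lambda>_. 1"] by simp
  then have [measurable]: "\<eta> b \<in> borel_measurable M'" for b
    by (simp add: centered_gaussian_rv_def)
  show "((\<lambda>\<epsilon>. LINT u|distr M borel (\<lambda>\<omega>. \<chi> i. eta_eps f \<epsilon> X (pts i) \<omega>). \<phi> u) \<longlongrightarrow>
      (LINT u|distr M' borel (\<lambda>\<omega>. \<chi> i. \<eta> (pts i) \<omega>). \<phi> u)) (at_right 0)"
    \<comment> \<open>The continuity theorem concerns sequences, and limits at 0 from the right are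
      determined by them.\<close>
    unfolding tendsto_at_iff_sequentially comp_def
  proof (intro allI impI)
    fix E :: "nat \<Rightarrow> real"
    assume "\<forall>n. E n \<in> {0<..} - {0}" and lim: "E \<longlonglongrightarrow> 0"
    then have pos: "\<And>n. 0 < E n" by auto
    let ?Y = "\<lambda>n \<omega>. \<chi> i. eta_eps f (E n) X (pts i) \<omega>" and ?Z = "\<lambda>\<omega>. \<chi> i. \<eta> (pts i) \<omega>"
    have Y [measurable]: "?Y n \<in> borel_measurable M" for n by (rule borel_measurable_vec_lambda) measurable
    have Z [measurable]: "?Z \<in> borel_measurable M'" by (rule borel_measurable_vec_lambda) measurable
    show "(\<lambda>n. LINT u|distr M borel (?Y n). \<phi> u) \<longlonglongrightarrow> (LINT u|distr M' borel ?Z. \<phi> u)"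
    proof (rule levy_continuity_vec[OF _ _ _ _ _ cont bdd])
      show "prob_space (distr M borel (?Y n))" for n by (rule prob_space_distr) simp
      show "prob_space (distr M' borel ?Z)" by (rule M'.prob_space_distr) simp
      show "(\<lambda>n. CLINT u|distr M borel (?Y n). iexp (w \<bullet> u)) \<longlonglongrightarrow> (CLINT u|distr M' borel ?Z. iexp (w \<bullet> u))" for w
        using eta_eps_char_tendsto[OF \<eta> pos lim, of "\<lambda>i. w $ i" pts]
        by (simp add: integral_distr inner_vec_def)
    qed auto
  qed
qed

end

theorem mainTheorem4:
  fixes f :: "real \<times> real \<times> real \<Rightarrow> real"
    and M :: "'a measure" and X :: "'a \<Rightarrow> (real \<times> real \<times> real \<times> real) set"
    and M' :: "'b measure" and \<eta> :: "real \<times> real \<Rightarrow> 'b \<Rightarrow> real"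
  assumes "f \<in> class_F"
    and "poisson_point_process M
           (density lborel (\<lambda>(x, v, r, z). ennreal (f (x, v, r)))) X"
    and "levy_chentsov_field M' (line_dist f) \<eta>"
  shows "(\<forall>pts :: 'n::finite \<Rightarrow> real \<times> real.
            conv_law_at0 M (\<lambda>\<epsilon> \<omega>. \<chi> i. eta_eps f \<epsilon> X (pts i) \<omega>)
                         M' (\<lambda>\<omega>. \<chi> i. \<eta> (pts i) \<omega>)) \<and>
         (\<forall>N :: 'm::finite \<Rightarrow> real \<times> real \<times> real.
            conv_law_at0 M
              (\<lambda>\<epsilon> \<omega>. \<chi> i. (case N i of (x, v, t) \<Rightarrow>
                   (y_eps \<epsilon> X v t x \<omega> - y_mean f v t x) / sqrt \<epsilon>))
              M' (\<lambda>\<omega>. \<chi> i. (case N i of (x, v, t) \<Rightarrow> \<eta> (t, x + v * t) \<omega>)))"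
proof -
  obtain \<gamma> where \<gamma>: "\<gamma> \<in> class_L" and bound: "\<And>v r x. \<bar>f (x, v, r)\<bar> \<le> \<gamma> (v, r)"
    using \<open>f \<in> class_F\<close> unfolding class_F_def by blast
  have intensity: "density lborel (\<lambda>(x, v, r, z). ennreal (f (x, v, r))) =
      density lborel (\<lambda>q. ennreal (f (proj3 q)))"
    by (rule arg_cong[where f="density lborel"]) (auto simp: proj3_def)
  interpret line_intensity f \<gamma>
  proof
    show "f \<in> borel_measurable borel" "\<And>p. 0 \<le> f p" "\<And>x. 0 < sigma_f f x"
      using \<open>f \<in> class_F\<close> unfolding class_F_def by auto
    show "\<gamma> \<in> borel_measurable borel"
        "(\<integral>\<^sup>+ y. ennreal ((fst y ^ 2 + snd y ^ 2 + 1) * \<gamma> y) \<partial>lborel) < \<infinity>"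
      using \<gamma> unfolding class_L_def by auto
    show "f (x, y) \<le> \<gamma> y" for x y
      using bound[of x "fst y" "snd y"] by simp
  qed
  interpret line_poisson f \<gamma> M X
    by standard (use assms(2) in \<open>simp only: intensity\<close>)
  have "conv_law_at0 M
      (\<lambda>\<epsilon> \<omega>. \<chi> i. (case N i of (x, v, t) \<Rightarrow> (y_eps \<epsilon> X v t x \<omega> - y_mean f v t x) / sqrt \<epsilon>))
      M' (\<lambda>\<omega>. \<chi> i. (case N i of (x, v, t) \<Rightarrow> \<eta> (t, x + v * t) \<omega>))"
    for N :: "'m \<Rightarrow> real \<times> real \<times> real"
    \<comment> \<open>The free motion x + v t cancels between \<open>y_eps\<close> and
      \<open>y_mean\<close>, leaving the field at (t, x + v t).\<close>
    using eta_eps_conv_law[OF assms(3), of "\<lambda>i. case N i of (x, v, t) \<Rightarrow> (t, x + v * t)"]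
    by (simp add: eta_eps_def y_eps_def y_mean_def case_prod_beta)
  then show ?thesis using eta_eps_conv_law[OF assms(3)] by blast
qed

end
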